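(* Consider the quantities computed by the $k$-step joint bidiagonalization (JBD) process in finite precision, with inner least squares problems solved accurately. Let $\hat\delta=O(c_4(m,n,p,k)\epsilon)$ with $c_4(m,n,p,k)=\|\underline B_k^{-1}\|+c_3(m,n,p)\|\widehat B_k^{-1}\|$, and let $\widehat U_k=\widehat M_k\widehat R_k$ and $V_k=N_kS_k$ be the compact QR factorizations of $\widehat U_k$ and $V_k$, where the diagonals of $\widehat R_k$ and $S_k$ are positive. If the semiorthogonality $$\xi(\widehat U_k),\ \xi(V_k)\le\sqrt{\hat\delta/(2k+1)}$$ holds, then $$\widehat M_k^TQ_LN_k=\bar B_k+\bar E_k,$$ where the elements of $\bar E_k$ are $O(\hat\delta)=O((\|\underline B_k^{-1}\|+\|\bar B_k^{-1}\|)\epsilon)$ in size.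
   Context: Setting. $A\in\mathbb{R}^{m\times n}$, $L\in\mathbb{R}^{p\times n}$ with $\mathrm{rank}\begin{pmatrix}A\\L\end{pmatrix}=n$. The compact QR factorization is $\begin{pmatrix}A\\L\end{pmatrix}=QR$ with $Q=\begin{pmatrix}Q_A\\Q_L\end{pmatrix}$, $Q^TQ=I_n$, $Q_A\in\mathbb{R}^{m\times n}$, $Q_L\in\mathbb{R}^{p\times n}$, $R$ nonsingular. $\|\cdot\|$ is the 2-norm, $\epsilon$ is the unit roundoff, and $e_j$ with $j=k$ or $k+1$ is the last column of $I_j$. For a matrix $W=(w_1,\dots,w_j)$, $\xi(W)=\max_{1\le i\ne l\le j}|w_i^Tw_l|$. JBD process (exact form). $\beta_1u_1=b$; $\alpha_1\tilde v_1=QQ^T(u_1^T,0_p^T)^T$; $\hat\alpha_1\hat u_1=\tilde v_1(m{+}1{:}m{+}p)$; and for $i\ge1$: $\beta_{i+1}u_{i+1}=\tilde v_i(1{:}m)-\alpha_iu_i$; $\alpha_{i+1}\tilde v_{i+1}=QQ^T(u_{i+1}^T,0_p^T)^T-\beta_{i+1}\tilde v_i$; $\hat\beta_i=\alpha_{i+1}\beta_{i+1}/\hat\alpha_i$; $\hat\alpha_{i+1}\hat u_{i+1}=(-1)^i\tilde v_{i+1}(m{+}1{:}m{+}p)-\hat\beta_i\hat u_i$. The vector $QQ^T(u_i^T,0_p^T)^T$ is obtained by solving the inner least squares problem $\min_x\|\begin{pmatrix}A\\L\end{pmatrix}x-\begin{pmatrix}u_i\\0_p\end{pmatrix}\|$.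 Notation (computed quantities). $U_{k+1}=(u_1,\dots,u_{k+1})\in\mathbb{R}^{m\times(k+1)}$, $\widetilde V_k=(\tilde v_1,\dots,\tilde v_k)\in\mathbb{R}^{(m+p)\times k}$, $\widehat U_k=(\hat u_1,\dots,\hat u_k)\in\mathbb{R}^{p\times k}$; all these vectors have unit length. $B_k\in\mathbb{R}^{(k+1)\times k}$ is lower bidiagonal with diagonal $\alpha_1,\dots,\alpha_k$ and subdiagonal $\beta_2,\dots,\beta_{k+1}$. $\widehat B_k\in\mathbb{R}^{k\times k}$ is upper bidiagonal with diagonal $\hat\alpha_1,\dots,\hat\alpha_k$ and superdiagonal $\hat\beta_1,\dots,\hat\beta_{k-1}$. $D_k=\mathrm{diag}(1,-1,\dots,(-1)^{k-1})$, $\bar B_k=\widehat B_kD_k$ (so $\|\bar B_k^{-1}\|=\|\widehat B_k^{-1}\|$). $\underline{B}_k=\begin{pmatrix}B_{k-1}^T\\ \alpha_ke_k^T\end{pmatrix}\in\mathbb{R}^{k\times k}$ is upper bidiagonal with diagonal $\alpha_1,\dots,\alpha_k$ and superdiagonal $\beta_2,\dots,\beta_k$. $\underline B_k$ and $\widehat B_k$ are assumed invertible. $v_i=Q^T\tilde v_i$, $V_k=(v_1,\dots,v_k)$. Finite precision model (with accurate inner solves). The computed quantities satisfy $(I_m,0_{m\times p})\widetilde V_k=U_{k+1}B_k+\widetilde F_k$, $QQ^T\begin{pmatrix}U_{k+1}\\0_{p\times(k+1)}\end{pmatrix}=\widetilde V_kB_k^T+\alpha_{k+1}\tilde v_{k+1}e_{k+1}^T+\widetilde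 G_{k+1}$, $(0_{p\times m},I_p)\widetilde V_kD_k=\widehat U_k\widehat B_k+\bar F_k$, with $\|\widetilde F_k\|,\|\widetilde G_{k+1}\|,\|\bar F_k\|=O(\epsilon)$. The computed scalar $\hat\beta_i$ is $(\alpha_{i+1}\beta_{i+1}/\hat\alpha_i)(1+\rho_i)$ with $|\rho_i|=O(\epsilon)$. Local orthogonality: $\beta_{i+1}|u_{i+1}^Tu_i|=O(c_1\epsilon)$ and $\hat\alpha_{i+1}|\hat u_{i+1}^T\hat u_i|=O(c_2\epsilon)$, with modest constants $c_1=c_1(m,n)$, $c_2=c_2(p,n)$ (taken $\ge1$); no $\beta_{i+1}$ or $\hat\alpha_{i+1}$ is negligible. $c_3(m,n,p)=c_1(m,n)+c_2(p,n)$. Standing assumption: $\|(\bar B_k\underline B_k)^{-1}\|\le c\sqrt2\,(\|\bar B_k^{-1}\|+\|\underline B_k^{-1}\|)$ for a constant $c$ slightly larger than $1$. Convention. $X=O(Y)$ means $|X|\le KY$ for a modest constant $K$ that does not depend on $\epsilon$, $\|\underline B_k^{-1}\|$ or $\|\widehat B_k^{-1}\|$ (it may depend on $k$, and on $c_1,c_2$ when these are not displayed), with $\epsilon$ (and $c_4\epsilon$) sufficiently small. "$\hat\delta=O(c_4\epsilon)$" means that $\hat\delta=\kappa c_4\epsilon$ for a fixed modest constant $\kappa>0$, on which the constants in the conclusion may depend. *)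

theory Defs
  imports Complex_Main
    "Jordan_Normal_Form.DL_Rank"
    "Jordan_Normal_Form.Gauss_Jordan_Elimination"
begin

definition vec_norm2 :: "real vec \<Rightarrow> real" where
  "vec_norm2 x = sqrt (x \<bullet> x)"

text \<open>The matrix 2-norm. The unit ball is used instead of the unit sphere, so that the supremum
  is over a nonempty set also for matrices without columns.\<close>

definition mat_norm2 :: "real mat \<Rightarrow> real" where
  "mat_norm2 M = (SUP x \<in> {x \<in> carrier_vec (dim_col M). vec_norm2 x \<le> 1}. vec_norm2 (M *\<^sub>v x))"

text \<open>Only meaningful for invertible matrices.\<close>

definition mat_inv :: "real mat \<Rightarrow> real mat" where
  "mat_inv M = the (mat_inverse M)"

text \<open>The level of orthogonality of the columns. Inserting 0 does not change the maximum of the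
  absolute values, and makes it 0 for a matrix with a single column.\<close>

definition xi :: "real mat \<Rightarrow> real" where
  "xi W = Max (insert 0 {\<bar>col W i \<bullet> col W l\<bar> | i l. i < dim_col W \<and> l < dim_col W \<and> i \<noteq> l})"

definition compact_qr :: "real mat \<Rightarrow> real mat \<Rightarrow> real mat \<Rightarrow> bool" where
  "compact_qr W Q R \<longleftrightarrow>
     Q \<in> carrier_mat (dim_row W) (dim_col W) \<and>
     R \<in> carrier_mat (dim_col W) (dim_col W) \<and>
     Q\<^sup>T * Q = 1\<^sub>m (dim_col W) \<and> upper_triangular R \<and> W = Q * R"

definition compact_qr_pos :: "real mat \<Rightarrow> real mat \<Rightarrow> real mat \<Rightarrow> bool" where
  "compact_qr_pos W Q R \<longleftrightarrow> compact_qr W Q R \<and> (\<forall>i < dim_row R. 0 < R $$ (i, i))"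

text \<open>Sequences of vectors and scalars are indexed from 1 (the value at 0 is never used), whereas
  rows and columns of a matrix are indexed from 0. Column \<open>j\<close> of the next matrix is \<open>w (j + 1)\<close>.\<close>

definition seq_mat :: "nat \<Rightarrow> nat \<Rightarrow> (nat \<Rightarrow> real vec) \<Rightarrow> real mat" where
  "seq_mat d j w = mat_of_cols d (map w [1..<j + 1])"

text \<open>\<open>B\<^sub>k\<close>: lower bidiagonal, diagonal \<open>\<alpha> 1, \<dots>, \<alpha> k\<close>, subdiagonal \<open>\<beta> 2, \<dots>, \<beta> (k + 1)\<close>.\<close>

definition B_mat :: "nat \<Rightarrow> (nat \<Rightarrow> real) \<Rightarrow> (nat \<Rightarrow> real) \<Rightarrow> real mat" where
  "B_mat k \<alpha> \<beta> = mat (k + 1) k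
     (\<lambda>(i, j). if i = j then \<alpha> (j + 1) else if i = j + 1 then \<beta> (j + 2) else 0)"

text \<open>\<open>B\<close> with hat: upper bidiagonal, diagonal \<open>\<alpha>h 1, \<dots>, \<alpha>h k\<close>,
  superdiagonal \<open>\<beta>h 1, \<dots>, \<beta>h (k - 1)\<close>.\<close>

definition B_hat :: "nat \<Rightarrow> (nat \<Rightarrow> real) \<Rightarrow> (nat \<Rightarrow> real) \<Rightarrow> real mat" where
  "B_hat k \<alpha>h \<beta>h = mat k k
     (\<lambda>(i, j). if i = j then \<alpha>h (i + 1) else if j = i + 1 then \<beta>h (i + 1) else 0)"

definition D_mat :: "nat \<Rightarrow> real mat" where
  "D_mat k = mat_diag k (\<lambda>i. (- 1) ^ i)"

definition B_bar :: "nat \<Rightarrow> (nat \<Rightarrow> real) \<Rightarrow> (nat \<Rightarrow> real) \<Rightarrow> real mat" where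
  "B_bar k \<alpha>h \<beta>h = B_hat k \<alpha>h \<beta>h * D_mat k"

text \<open>\<open>B\<close> with a bar below, for \<open>k \<ge> 1\<close>; \<open>unit_vec k (k - 1)\<close> is the last column of the identity.\<close>

definition B_under :: "nat \<Rightarrow> (nat \<Rightarrow> real) \<Rightarrow> (nat \<Rightarrow> real) \<Rightarrow> real mat" where
  "B_under k \<alpha> \<beta> = (B_mat (k - 1) \<alpha> \<beta>)\<^sup>T @\<^sub>r mat_of_row (\<alpha> k \<cdot>\<^sub>v unit_vec k (k - 1))"

definition V_mat :: "nat \<Rightarrow> nat \<Rightarrow> real mat \<Rightarrow> (nat \<Rightarrow> real vec) \<Rightarrow> real mat" where
  "V_mat n k Q vt = seq_mat n k (\<lambda>i. Q\<^sup>T *\<^sub>v vt i)"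

definition c3 :: "real \<Rightarrow> real \<Rightarrow> real" where
  "c3 c1 c2 = c1 + c2"

definition c4 :: "real \<Rightarrow> real \<Rightarrow> nat \<Rightarrow> (nat \<Rightarrow> real) \<Rightarrow> (nat \<Rightarrow> real)
    \<Rightarrow> (nat \<Rightarrow> real) \<Rightarrow> (nat \<Rightarrow> real) \<Rightarrow> real" where
  "c4 c1 c2 k \<alpha> \<beta> \<alpha>h \<beta>h =
     mat_norm2 (mat_inv (B_under k \<alpha> \<beta>)) + c3 c1 c2 * mat_norm2 (mat_inv (B_hat k \<alpha>h \<beta>h))"

locale joint_qr =
  fixes m n p :: nat
    and A L QA QL R :: "real mat"
  assumes A_dim: "A \<in> carrier_mat m n"
    and L_dim: "L \<in> carrier_mat p n"
    and full_rank: "vec_space.rank (m + p) (A @\<^sub>r L) = n"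
    and QA_dim: "QA \<in> carrier_mat m n"
    and QL_dim: "QL \<in> carrier_mat p n"
    and qr_A_L: "compact_qr (A @\<^sub>r L) (QA @\<^sub>r QL) R"
    and R_nonsingular: "invertible_mat R"

text \<open>
  The quantities computed by \<open>k\<close> steps of the joint bidiagonalization process in finite precision
  with unit roundoff \<open>\<epsilon>\<close> and accurate inner solves. One constant \<open>C\<close> stands for all the constants
  hidden in the \<open>O\<close> symbols of the model. Here \<open>vt\<close> is \<open>v\<close> with tilde; \<open>uh\<close>, \<open>\<alpha>h\<close>, \<open>\<beta>h\<close> are
  \<open>u\<close>, \<open>\<alpha>\<close>, \<open>\<beta>\<close> with hat. \<open>(1\<^sub>m m @\<^sub>r 0\<^sub>m p m)\<^sup>T\<close> is the block row \<open>(I, 0)\<close>, and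
  \<open>(0\<^sub>m m p @\<^sub>r 1\<^sub>m p)\<^sup>T\<close> is \<open>(0, I)\<close>.

  The scalars \<open>\<alpha>\<close>, \<open>\<beta>\<close>, \<open>\<alpha>h\<close> normalize vectors to unit length and are therefore
  nonnegative. That no \<open>\<beta>\<close> or \<open>\<alpha>h\<close> is negligible is required in its weakest form, as
  positivity without a lower bound.
\<close>

locale jbd_finite_precision = joint_qr m n p A L QA QL R
  for m n p :: nat and A L QA QL R :: "real mat" +
  fixes k :: nat and C c1 c2 \<epsilon> :: real
    and u vt uh :: "nat \<Rightarrow> real vec"
    and \<alpha> \<beta> \<alpha>h \<beta>h :: "nat \<Rightarrow> real"
  assumes eps_pos: "0 < \<epsilon>"
    and u_unit: "\<And>i. i \<in> {1..k + 1} \<Longrightarrow> u i \<in> carrier_vec m \<and> vec_norm2 (u i) = 1"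
    and vt_unit: "\<And>i. i \<in> {1..k} \<Longrightarrow> vt i \<in> carrier_vec (m + p) \<and> vec_norm2 (vt i) = 1"
    and vt_next: "vt (k + 1) \<in> carrier_vec (m + p)"
    and uh_unit: "\<And>i. i \<in> {1..k} \<Longrightarrow> uh i \<in> carrier_vec p \<and> vec_norm2 (uh i) = 1"
    and \<alpha>_nonneg: "\<And>i. i \<in> {1..k + 1} \<Longrightarrow> 0 \<le> \<alpha> i"
    and \<beta>_pos: "\<And>i. i \<in> {2..k + 1} \<Longrightarrow> 0 < \<beta> i"
    and \<alpha>h_pos: "\<And>i. i \<in> {1..k} \<Longrightarrow> 0 < \<alpha>h i"
    and B_under_invertible: "invertible_mat (B_under k \<alpha> \<beta>)"
    and B_hat_invertible: "invertible_mat (B_hat k \<alpha>h \<beta>h)"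
    and recurrence_A:
      "\<exists>F \<in> carrier_mat m k. mat_norm2 F \<le> C * \<epsilon> \<and>
         (1\<^sub>m m @\<^sub>r 0\<^sub>m p m)\<^sup>T * seq_mat (m + p) k vt = seq_mat m (k + 1) u * B_mat k \<alpha> \<beta> + F"
    and recurrence_Q:
      "\<exists>G \<in> carrier_mat (m + p) (k + 1). mat_norm2 G \<le> C * \<epsilon> \<and>
         (QA @\<^sub>r QL) * (QA @\<^sub>r QL)\<^sup>T * (seq_mat m (k + 1) u @\<^sub>r 0\<^sub>m p (k + 1)) =
           seq_mat (m + p) k vt * (B_mat k \<alpha> \<beta>)\<^sup>T
           + \<alpha> (k + 1) \<cdot>\<^sub>m (mat_of_cols (m + p) [vt (k + 1)] * mat_of_row (unit_vec (k + 1) k))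
           + G"
    and recurrence_L:
      "\<exists>F \<in> carrier_mat p k. mat_norm2 F \<le> C * \<epsilon> \<and>
         (0\<^sub>m m p @\<^sub>r 1\<^sub>m p)\<^sup>T * seq_mat (m + p) k vt * D_mat k =
           seq_mat p k uh * B_hat k \<alpha>h \<beta>h + F"
    and \<beta>h_computed:
      "\<And>i. i \<in> {1..<k} \<Longrightarrow>
         \<exists>\<rho>. \<bar>\<rho>\<bar> \<le> C * \<epsilon> \<and> \<beta>h i = \<alpha> (i + 1) * \<beta> (i + 1) / \<alpha>h i * (1 + \<rho>)"
    and local_orth_u:
      "\<And>i. i \<in> {1..k} \<Longrightarrow> \<beta> (i + 1) * \<bar>u (i + 1) \<bullet> u i\<bar> \<le> C * c1 * \<epsilon>"
    and local_orth_uh: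
      "\<And>i. i \<in> {1..<k} \<Longrightarrow> \<alpha>h (i + 1) * \<bar>uh (i + 1) \<bullet> uh i\<bar> \<le> C * c2 * \<epsilon>"

end

theory Submission
  imports Defs "HOL-Analysis.L2_Norm"
begin

text \<open>
  Write \<open>V\<close>, \<open>U\<close>, \<open>B\<close> for \<open>V_mat\<close>, the matrix of the \<open>uh\<close>, and \<open>B_bar\<close>, let \<open>U = M R\<close> and \<open>V = N S\<close> be
  the QR factorizations, \<open>T = M\<^sup>T QL N\<close>, and let \<open>\<theta> = c4 \<epsilon>\<close>, so that \<open>\<delta>\<close> is a multiple of \<open>\<theta>\<close>.
  Two relations hold up to a multiple of \<open>\<theta>\<close>:

  \<^item> the forward relation \<open>QL V = U B\<close> (\<open>QL_v_relation\<close>), which becomes \<open>T S = R B\<close>;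

  \<^item> the adjoint relation \<open>QL\<^sup>T U = V B\<^sup>T\<close> in all columns but the last (\<open>uh_QL_relation\<close>), which
    becomes \<open>R\<^sup>T T = B S\<^sup>T\<close> in all rows but the last.

  Semiorthogonality makes \<open>R\<close> and \<open>S\<close> differ from the identity by as much as the square root of \<open>\<theta>\<close>,
  so that \<open>T = R B S\<^sup>-\<^sup>1\<close> alone gives too little. On the diagonals, however, the difference is
  only of order \<open>\<theta>\<close> (\<open>cholesky_diagonal_near_one\<close>), and the triangular shapes arrange that only the
  diagonals matter: \<open>R B\<close> is upper triangular, and \<open>B S\<^sup>T\<close> has only one diagonal
  above the main one, since \<open>B\<close> is upper bidiagonal. So the forward relation fixes \<open>T\<close> on and below the
  diagonal, the adjoint relation fixes it above, in both cases by forward substitution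
  with a triangular matrix whose entries are bounded and whose diagonal is bounded from below
  (\<open>projected_matrix_near_B_bar\<close>). The last row of \<open>T\<close> has no entry above the diagonal, so the
  missing row of the adjoint relation does no harm.

  For the forward relation, the vectors \<open>vt\<close> must lie in the range of \<open>Q\<close> up to \<open>\<theta>\<close>. Their components
  orthogonal to it satisfy a recurrence with matrix \<open>B_under\<close> driven by rounding errors, which brings
  in the norm of the inverse of \<open>B_under\<close> (\<open>vt_near_range_Q\<close>). For the adjoint relation, the difference
  of the two sides times \<open>B\<close> is the residual of the identity \<open>B\<^sup>T B = I - B_mat\<^sup>T B_mat\<close>. Its
  diagonal comes from the unit length of the \<open>vt\<close> and local orthogonality, which brings in \<open>c3\<close>;
  its off-diagonal entries come from the formula for \<open>\<beta>h\<close>. Division by \<open>B\<close> brings in the norm of the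
  inverse of \<open>B_hat\<close>.

  Everything is stated in scalar form, tested against one vector of norm at most 1. In the end only
  the entries of \<open>T\<close> matter, and these arise by testing with the columns of \<open>M\<close> and \<open>N\<close>.
\<close>

section \<open>Vector and matrix norms\<close>

lemma vec_norm2_L2_set: "vec_norm2 x = L2_set (\<lambda>i. x $ i) {0..<dim_vec x}"
  by (simp add: vec_norm2_def L2_set_def scalar_prod_def power2_eq_square)

lemma vec_norm2_nonneg: "0 \<le> vec_norm2 x"
  by (simp add: vec_norm2_L2_set)

lemma vec_norm2_square: "(vec_norm2 x)\<^sup>2 = x \<bullet> x"
  by (simp add: vec_norm2_def scalar_prod_def sum_nonneg)

lemma vec_norm2_eq_1_iff: "vec_norm2 x = 1 \<longleftrightarrow> x \<bullet> x = 1"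
  by (simp add: vec_norm2_def)

lemma abs_scalar_prod_le:
  assumes "x \<in> carrier_vec n" "y \<in> carrier_vec n"
  shows "\<bar>x \<bullet> y\<bar> \<le> vec_norm2 x * vec_norm2 y"
proof -
  have "\<bar>x \<bullet> y\<bar> \<le> (\<Sum>i\<in>{0..<n}. \<bar>x $ i * y $ i\<bar>)"
    using assms unfolding scalar_prod_def by (auto intro: sum_abs)
  also have "\<dots> = (\<Sum>i\<in>{0..<n}. \<bar>x $ i\<bar> * \<bar>y $ i\<bar>)" by (simp add: abs_mult)
  also have "\<dots> \<le> L2_set (\<lambda>i. x $ i) {0..<n} * L2_set (\<lambda>i. y $ i) {0..<n}"
    by (rule L2_set_mult_ineq)
  finally show ?thesis using assms by (simp add: vec_norm2_L2_set)
qed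

lemma abs_scalar_prod_le_bound:
  assumes "x \<in> carrier_vec n" "y \<in> carrier_vec n" "vec_norm2 x \<le> 1" "vec_norm2 y \<le> d"
  shows "\<bar>x \<bullet> y\<bar> \<le> d"
proof -
  have "vec_norm2 x * vec_norm2 y \<le> 1 * d"
    by (rule mult_mono) (use assms vec_norm2_nonneg[of y] in auto)
  then show ?thesis using abs_scalar_prod_le[OF assms(1,2)] by simp
qed

lemma vec_norm2_smult: "vec_norm2 (a \<cdot>\<^sub>v x) = \<bar>a\<bar> * vec_norm2 x"
proof -
  have "(a \<cdot>\<^sub>v x) \<bullet> (a \<cdot>\<^sub>v x) = a\<^sup>2 * (x \<bullet> x)"
    by (simp add: scalar_prod_def sum_distrib_left power2_eq_square algebra_simps)
  then show ?thesis by (simp add: vec_norm2_def real_sqrt_mult)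
qed

lemma abs_vec_index_le_norm2:
  assumes "i < dim_vec x"
  shows "\<bar>x $ i\<bar> \<le> vec_norm2 x"
proof -
  have "\<bar>x $ i\<bar> \<le> L2_set (\<lambda>i. \<bar>x $ i\<bar>) {0..<dim_vec x}"
    by (rule member_le_L2_set) (use assms in auto)
  then show ?thesis by (simp add: vec_norm2_L2_set L2_set_def)
qed

text \<open>A supremum in the reals says something only if the set is bounded; here the sum of the norms
  of the rows is a bound.\<close>

lemma bdd_above_mat_norm2:
  "bdd_above ((\<lambda>x. vec_norm2 (M *\<^sub>v x)) ` {x \<in> carrier_vec (dim_col M). vec_norm2 x \<le> 1})"
proof (rule bdd_aboveI2)
  fix x assume x: "x \<in> {x \<in> carrier_vec (dim_col M). vec_norm2 x \<le> 1}"
  have "vec_norm2 (M *\<^sub>v x) \<le> (\<Sum>i\<in>{0..<dim_row M}. \<bar>(M *\<^sub>v x) $ i\<bar>)"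
    using L2_set_le_sum_abs[of "\<lambda>i. (M *\<^sub>v x) $ i" "{0..<dim_row M}"]
    by (simp only: vec_norm2_L2_set dim_mult_mat_vec)
  also have "\<dots> \<le> (\<Sum>i\<in>{0..<dim_row M}. vec_norm2 (row M i))"
  proof (rule sum_mono)
    fix i assume "i \<in> {0..<dim_row M}"
    then show "\<bar>(M *\<^sub>v x) $ i\<bar> \<le> vec_norm2 (row M i)"
      using abs_scalar_prod_le_bound[of x "dim_col M" "row M i" "vec_norm2 (row M i)"] x
      by (simp add: comm_scalar_prod[of x "dim_col M"])
  qed
  finally show "vec_norm2 (M *\<^sub>v x) \<le> (\<Sum>i\<in>{0..<dim_row M}. vec_norm2 (row M i))" .
qed

lemma vec_norm2_mult_le:
  assumes "x \<in> carrier_vec (dim_col M)" "vec_norm2 x \<le> 1"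
  shows "vec_norm2 (M *\<^sub>v x) \<le> mat_norm2 M"
  unfolding mat_norm2_def by (rule cSUP_upper[OF _ bdd_above_mat_norm2]) (use assms in auto)

lemma vec_norm2_col_le:
  assumes "j < dim_col M"
  shows "vec_norm2 (col M j) \<le> mat_norm2 M"
proof -
  have "vec_norm2 (unit_vec (dim_col M) j) = 1"
    using assms by (simp add: vec_norm2_def)
  moreover have "M *\<^sub>v unit_vec (dim_col M) j = col M j"
    using assms by (intro eq_vecI) auto
  ultimately show ?thesis
    using vec_norm2_mult_le[of "unit_vec (dim_col M) j" M] by simp
qed

lemma abs_mat_index_le_norm2:
  assumes "i < dim_row M" "j < dim_col M"
  shows "\<bar>M $$ (i, j)\<bar> \<le> mat_norm2 M"
  using abs_vec_index_le_norm2[of i "col M j"] vec_norm2_col_le[of j M] assms by simp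

lemma mat_norm2_nonneg: "0 \<le> mat_norm2 M"
proof -
  have "vec_norm2 (M *\<^sub>v 0\<^sub>v (dim_col M)) \<le> mat_norm2 M"
    by (rule vec_norm2_mult_le) (auto simp: vec_norm2_def)
  then show ?thesis using vec_norm2_nonneg order_trans by blast
qed

lemma mat_inv_works:
  assumes M: "M \<in> carrier_mat k k" and inv: "invertible_mat M"
  shows "mat_inv M \<in> carrier_mat k k" "M * mat_inv M = 1\<^sub>m k" "mat_inv M * M = 1\<^sub>m k"
proof -
  obtain B where B: "inverts_mat M B" "inverts_mat B M"
    using inv unfolding invertible_mat_def by blast
  have "dim_row B = k"
    using B(2) M unfolding inverts_mat_def
    by (metis index_mult_mat(3) index_one_mat(3) carrier_matD(2))
  moreover have "dim_col B = k"
    using B(1) M unfolding inverts_mat_def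
    by (metis index_mult_mat(3) index_one_mat(3) carrier_matD(1))
  ultimately have Bk: "B \<in> carrier_mat k k" by auto
  then have "B * M = 1\<^sub>m k" "M * B = 1\<^sub>m k"
    using B M unfolding inverts_mat_def by auto
  then have "M \<in> Units (ring_mat TYPE(real) k ())"
    using M Bk unfolding Units_def by (auto simp: ring_mat_simps)
  then have "mat_inverse M \<noteq> None"
    using mat_inverse(1)[OF M, of "()"] by blast
  then obtain Z where "mat_inverse M = Some Z" by blast
  moreover from this have "M * Z = 1\<^sub>m k \<and> Z * M = 1\<^sub>m k \<and> Z \<in> carrier_mat k k"
    by (rule mat_inverse(2)[OF M])
  ultimately show "mat_inv M \<in> carrier_mat k k" "M * mat_inv M = 1\<^sub>m k" "mat_inv M * M = 1\<^sub>m k"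
    unfolding mat_inv_def by auto
qed

lemma mat_inv_eqI:
  assumes M: "M \<in> carrier_mat k k" and Y: "Y \<in> carrier_mat k k"
    and MY: "M * Y = 1\<^sub>m k" "Y * M = 1\<^sub>m k"
  shows "mat_inv M = Y"
proof -
  have "invertible_mat M"
    using assms unfolding invertible_mat_def inverts_mat_def square_mat.simps by (metis carrier_matD)
  note I = mat_inv_works[OF M this]
  have "mat_inv M = (Y * M) * mat_inv M" using I(1) MY(2) by simp
  also have "\<dots> = Y * (M * mat_inv M)" using M Y I(1) by (intro assoc_mult_mat) auto
  finally show ?thesis using I(2) Y by simp
qed

text \<open>In a row-vector equation the inverse acts from the right, and each component of the solution is
  a sum of \<open>k\<close> products of residuals with entries of the inverse. The equations are assumed only as
  bounds on scalars, so that the lemma applies to vector recurrences tested against one vector.\<close>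

lemma left_solve_bound:
  assumes M: "M \<in> carrier_mat k k" and inv: "invertible_mat M"
    and res: "\<And>j. j < k \<Longrightarrow> \<bar>\<Sum>i<k. x i * M $$ (i, j)\<bar> \<le> d"
    and i: "i < k"
  shows "\<bar>x i\<bar> \<le> real k * d * mat_norm2 (mat_inv M)"
proof -
  note I = mat_inv_works[OF M inv]
  let ?Y = "mat_inv M"
  have d0: "0 \<le> d" using res[OF i] by linarith
  have del: "(\<Sum>j<k. M $$ (l, j) * ?Y $$ (j, i)) = (if l = i then 1 else 0)" if "l < k" for l
  proof -
    have "(M * ?Y) $$ (l, i) = (\<Sum>j<k. M $$ (l, j) * ?Y $$ (j, i))"
      using M I(1) that i by (simp add: scalar_prod_def atLeast0LessThan)
    then show ?thesis using I(2) that i by simp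
  qed
  have "x i = (\<Sum>l<k. x l * (if l = i then 1 else 0))"
    using i by (simp add: if_distrib cong: if_cong)
  also have "\<dots> = (\<Sum>l<k. x l * (\<Sum>j<k. M $$ (l, j) * ?Y $$ (j, i)))"
    by (intro sum.cong refl) (simp add: del)
  also have "\<dots> = (\<Sum>l<k. \<Sum>j<k. x l * M $$ (l, j) * ?Y $$ (j, i))"
    by (simp add: sum_distrib_left mult.assoc)
  also have "\<dots> = (\<Sum>j<k. \<Sum>l<k. x l * M $$ (l, j) * ?Y $$ (j, i))"
    by (rule sum.swap)
  also have "\<dots> = (\<Sum>j<k. (\<Sum>l<k. x l * M $$ (l, j)) * ?Y $$ (j, i))"
    by (simp add: sum_distrib_right)
  also have "\<bar>\<dots>\<bar> \<le> (\<Sum>j<k. \<bar>(\<Sum>l<k. x l * M $$ (l, j)) * ?Y $$ (j, i)\<bar>)"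
    by (rule sum_abs)
  also have "\<dots> \<le> (\<Sum>j<k. d * mat_norm2 ?Y)"
  proof (rule sum_mono)
    fix j assume "j \<in> {..<k}"
    then have "\<bar>?Y $$ (j, i)\<bar> \<le> mat_norm2 ?Y"
      using abs_mat_index_le_norm2[of j ?Y i] I(1) i by auto
    then show "\<bar>(\<Sum>l<k. x l * M $$ (l, j)) * ?Y $$ (j, i)\<bar> \<le> d * mat_norm2 ?Y"
      unfolding abs_mult using res[of j] \<open>j \<in> {..<k}\<close> d0 by (intro mult_mono) auto
  qed
  finally show ?thesis by simp
qed

section \<open>Triangular systems close to the identity\<close>

text \<open>The bound \<open>2 * 3 ^ j * d\<close> is what the recursion \<open>x\<^sub>j \<le> 2 (d + \<Sum>l<j. x\<^sub>l)\<close> gives; the factor 2 is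
  the bound for the inverse of a diagonal entry.\<close>

lemma forward_substitution_bound:
  fixes x :: "nat \<Rightarrow> real" and S :: "nat \<Rightarrow> nat \<Rightarrow> real"
  assumes diag: "\<And>j. j < n \<Longrightarrow> 1 / 2 \<le> S j j"
    and off: "\<And>l j. l < j \<Longrightarrow> j < n \<Longrightarrow> \<bar>S l j\<bar> \<le> 1"
    and res: "\<And>j. j < n \<Longrightarrow> \<bar>\<Sum>l\<le>j. x l * S l j\<bar> \<le> d"
    and j: "j < n"
  shows "\<bar>x j\<bar> \<le> 2 * 3 ^ j * d"
  using j
proof (induction j rule: less_induct)
  case (less j)
  have geom: "(\<Sum>l<j. 2 * 3 ^ l * d) = (3 ^ j - 1) * d"
    by (induction j) (auto simp: algebra_simps)
  have "\<bar>\<Sum>l<j. x l * S l j\<bar> \<le> (\<Sum>l<j. \<bar>x l * S l j\<bar>)" by (rule sum_abs)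
  also have "\<dots> \<le> (\<Sum>l<j. 2 * 3 ^ l * d)"
  proof (rule sum_mono)
    fix l assume "l \<in> {..<j}"
    then have "\<bar>x l\<bar> * \<bar>S l j\<bar> \<le> (2 * 3 ^ l * d) * 1"
      using less off[of l j] order_trans[OF abs_ge_zero less.IH[of l]]
      by (intro mult_mono) auto
    then show "\<bar>x l * S l j\<bar> \<le> 2 * 3 ^ l * d" by (simp add: abs_mult)
  qed
  finally have s: "\<bar>\<Sum>l<j. x l * S l j\<bar> \<le> (3 ^ j - 1) * d" unfolding geom .
  have "(\<Sum>l\<le>j. x l * S l j) = (\<Sum>l<j. x l * S l j) + x j * S j j"
    by (simp add: lessThan_Suc_atMost[symmetric])
  then have "\<bar>x j * S j j\<bar> \<le> 3 ^ j * d"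
    using res[OF less.prems] s by (simp add: algebra_simps)
  moreover have "\<bar>x j\<bar> * (1 / 2) \<le> \<bar>x j\<bar> * S j j"
    using diag[OF less.prems] by (intro mult_left_mono) auto
  ultimately show ?case using diag[OF less.prems] by (simp add: abs_mult)
qed

text \<open>Semiorthogonality, that is, orthogonality only to the level of the square root of the working
  precision, is enough because the off-diagonal entries of the Cholesky factor enter its diagonal
  squared: off-diagonal entries of size \<open>\<mu>\<close> of the Gram matrix perturb the diagonal of the factor by
  a multiple of \<open>\<mu>\<^sup>2\<close>.\<close>

lemma cholesky_diagonal_near_one:
  fixes S :: "nat \<Rightarrow> nat \<Rightarrow> real"
  assumes pos: "\<And>j. j < n \<Longrightarrow> 0 < S j j"
    and off_le: "\<And>l j. l < j \<Longrightarrow> j < n \<Longrightarrow> \<bar>S l j\<bar> \<le> 1"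
    and gram_diag: "\<And>j. j < n \<Longrightarrow> \<bar>(\<Sum>l\<le>j. (S l j)\<^sup>2) - 1\<bar> \<le> \<nu>"
    and gram_off: "\<And>i j. i < j \<Longrightarrow> j < n \<Longrightarrow> \<bar>\<Sum>l\<le>i. S l i * S l j\<bar> \<le> \<mu>"
    and small: "\<nu> + 4 * real n * 9 ^ n * \<mu>\<^sup>2 \<le> 1 / 2"
    and j: "j < n"
  shows "\<bar>S j j - 1\<bar> \<le> \<nu> + 4 * real n * 9 ^ n * \<mu>\<^sup>2"
  using j
proof (induction j rule: less_induct)
  case (less j)
  have half: "1 / 2 \<le> S i i" if "i < j" for i
    using less.IH[OF that] that less.prems small by auto
  have term_le: "(S i j)\<^sup>2 \<le> 4 * 9 ^ n * \<mu>\<^sup>2" if i: "i < j" for i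
  proof -
    have "0 \<le> \<mu>" using gram_off[OF i less.prems] by linarith
    have "\<bar>S i j\<bar> \<le> 2 * 3 ^ i * \<mu>"
    proof (rule forward_substitution_bound[where S = S and n = j])
      show "\<bar>\<Sum>l\<le>i. S l j * S l i\<bar> \<le> \<mu>" if "i < j" for i
        using gram_off[OF that less.prems] by (simp add: mult.commute)
    qed (use half off_le less.prems i in auto)
    also have "\<dots> \<le> 2 * 3 ^ n * \<mu>"
      using \<open>0 \<le> \<mu>\<close> i less.prems by (intro mult_right_mono mult_left_mono power_increasing) auto
    finally have "\<bar>S i j\<bar>\<^sup>2 \<le> (2 * 3 ^ n * \<mu>)\<^sup>2" by (intro power_mono) auto
    moreover have "(2 * 3 ^ n * \<mu>)\<^sup>2 = 4 * 9 ^ n * \<mu>\<^sup>2"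
      by (simp add: power2_eq_square mult_ac flip: power_mult_distrib)
    ultimately show ?thesis by simp
  qed
  have "(\<Sum>l<j. (S l j)\<^sup>2) \<le> (\<Sum>l<j. 4 * 9 ^ n * \<mu>\<^sup>2)"
    by (rule sum_mono) (use term_le in auto)
  also have "\<dots> \<le> real n * (4 * 9 ^ n * \<mu>\<^sup>2)"
    using less.prems by (simp add: mult_right_mono)
  finally have off_sum: "(\<Sum>l<j. (S l j)\<^sup>2) \<le> 4 * real n * 9 ^ n * \<mu>\<^sup>2" by simp
  have "(\<Sum>l\<le>j. (S l j)\<^sup>2) = (\<Sum>l<j. (S l j)\<^sup>2) + (S j j)\<^sup>2"
    by (simp add: lessThan_Suc_atMost[symmetric])
  moreover have "0 \<le> (\<Sum>l<j. (S l j)\<^sup>2)" by (simp add: sum_nonneg)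
  ultimately have sq: "\<bar>(S j j)\<^sup>2 - 1\<bar> \<le> \<nu> + 4 * real n * 9 ^ n * \<mu>\<^sup>2"
    using gram_diag[OF less.prems] off_sum by linarith
  have "\<bar>S j j - 1\<bar> * 1 \<le> \<bar>S j j - 1\<bar> * (S j j + 1)"
    using pos[OF less.prems] by (intro mult_left_mono) auto
  also have "\<dots> = \<bar>(S j j)\<^sup>2 - 1\<bar>"
    using pos[OF less.prems] by (simp add: power2_eq_square square_diff_one_factored abs_mult)
  finally show ?case using sq by simp
qed

section \<open>Unit vectors that are nearly orthogonal\<close>

text \<open>By Pythagoras up to the cross term. The local orthogonality of \<open>u\<close> and \<open>w\<close> is known only after
  multiplication by one of the two coefficients, so the cross term is of the order of the other
  coefficient, and this has to be absorbed by the squares first. The threshold 1/8 is a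
  convenient one for which both coefficients are at most 2.\<close>

lemma combination_of_two_unit_vectors:
  assumes x: "x = a \<cdot>\<^sub>v u + b \<cdot>\<^sub>v w + f" "x \<in> carrier_vec n" "vec_norm2 x \<le> 1"
    and u: "u \<in> carrier_vec n" "vec_norm2 u = 1" and w: "w \<in> carrier_vec n" "vec_norm2 w = 1"
    and f: "f \<in> carrier_vec n" "vec_norm2 f \<le> \<phi>"
    and loc: "\<bar>a * b * (u \<bullet> w)\<bar> \<le> \<bar>a\<bar> * \<gamma>"
    and small: "\<phi> \<le> 1 / 8" "0 \<le> \<gamma>" "\<gamma> \<le> 1 / 8"
  shows "\<bar>a\<bar> \<le> 2" "\<bar>b\<bar> \<le> 2" "\<bar>a\<^sup>2 + b\<^sup>2 - x \<bullet> x\<bar> \<le> 3 * \<phi> + 4 * \<gamma>"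
proof -
  define y where "y = a \<cdot>\<^sub>v u + b \<cdot>\<^sub>v w"
  have yc: "y \<in> carrier_vec n" using u w by (simp add: y_def)
  have xy: "x = y + f" using x(1) by (simp add: y_def)
  have phi0: "0 \<le> \<phi>" using f(2) vec_norm2_nonneg[of f] by linarith
  have uu: "u \<bullet> u = 1" "w \<bullet> w = 1" using u(2) w(2) by (simp_all add: vec_norm2_eq_1_iff)
  have "y \<bullet> y = a\<^sup>2 * (u \<bullet> u) + b\<^sup>2 * (w \<bullet> w) + 2 * (a * b * (u \<bullet> w))"
    unfolding y_def using u(1) w(1)
    by (simp add: add_scalar_prod_distrib[of _ n] scalar_prod_add_distrib[of _ n]
        comm_scalar_prod[of w n u] power2_eq_square algebra_simps)
  then have yy: "y \<bullet> y = a\<^sup>2 + b\<^sup>2 + 2 * (a * b * (u \<bullet> w))" by (simp add: uu)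
  have "x \<bullet> x = y \<bullet> y + 2 * (y \<bullet> f) + f \<bullet> f"
    unfolding xy using yc f(1)
    by (simp add: add_scalar_prod_distrib[of _ n] scalar_prod_add_distrib[of _ n]
        comm_scalar_prod[of f n y])
  moreover have xf: "x \<bullet> f = y \<bullet> f + f \<bullet> f"
    unfolding xy using yc f(1) by (simp add: add_scalar_prod_distrib[of _ n])
  ultimately have xx: "x \<bullet> x = y \<bullet> y + 2 * (x \<bullet> f) - f \<bullet> f" by simp
  have ff: "0 \<le> f \<bullet> f" "f \<bullet> f \<le> \<phi>\<^sup>2"
    using zero_le_power2[of "vec_norm2 f"] power_mono[OF f(2) vec_norm2_nonneg, of 2]
    unfolding vec_norm2_square by auto
  have phi2: "\<phi>\<^sup>2 \<le> \<phi>" using phi0 small(1) by (simp add: power2_eq_square mult_left_le)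
  have "\<bar>x \<bullet> f\<bar> \<le> \<phi>" by (rule abs_scalar_prod_le_bound) (use x f in auto)
  then have yx: "\<bar>y \<bullet> y - x \<bullet> x\<bar> \<le> 3 * \<phi>" using xx ff phi2 by linarith
  have "x \<bullet> x \<le> 1"
    using vec_norm2_square[of x] x(3) vec_norm2_nonneg[of x] power_le_one[of "vec_norm2 x" 2] by auto
  then have "y \<bullet> y \<le> 11 / 8" using yx small by linarith
  then have sum: "a\<^sup>2 + b\<^sup>2 \<le> 11 / 8 + 2 * (\<bar>a\<bar> * \<gamma>)" using yy loc by linarith
  have ag: "\<bar>a\<bar> * \<gamma> \<le> \<bar>a\<bar> * (1 / 8)" using small by (intro mult_left_mono) auto
  have a2: "\<bar>a\<bar> * \<bar>a\<bar> \<le> 11 / 8 + \<bar>a\<bar> / 4"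
    using sum ag zero_le_power2[of b] by (simp only: power2_eq_square abs_mult_self_eq)
  show a: "\<bar>a\<bar> \<le> 2"
  proof (rule ccontr)
    assume "\<not> \<bar>a\<bar> \<le> 2"
    then have "2 * \<bar>a\<bar> \<le> \<bar>a\<bar> * \<bar>a\<bar>" by (intro mult_right_mono) auto
    then show False using a2 \<open>\<not> \<bar>a\<bar> \<le> 2\<close> by linarith
  qed
  have "b\<^sup>2 \<le> 4" using sum ag a zero_le_power2[of a] by linarith
  then show "\<bar>b\<bar> \<le> 2" using abs_le_square_iff[of b 2] by simp
  have "\<bar>a\<bar> * \<gamma> \<le> 2 * \<gamma>" using a small by (intro mult_right_mono) auto
  then show "\<bar>a\<^sup>2 + b\<^sup>2 - x \<bullet> x\<bar> \<le> 3 * \<phi> + 4 * \<gamma>" using yy loc yx by linarith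
qed

section \<open>Matrices with orthonormal columns\<close>

lemma col_append_rows:
  assumes "A \<in> carrier_mat r1 n" "B \<in> carrier_mat r2 n" "j < n"
  shows "col (A @\<^sub>r B) j = col A j @\<^sub>v col B j"
  using assms by (intro eq_vecI) (auto simp: append_rows_def)

lemma append_rows_index:
  assumes "A \<in> carrier_mat r1 n" "B \<in> carrier_mat r2 n" "i < r1 + r2" "j < n"
  shows "(A @\<^sub>r B) $$ (i, j) = (if i < r1 then A $$ (i, j) else B $$ (i - r1, j))"
  using assms by (auto simp: append_rows_def)

lemma transpose_append_rows_mult_vec:
  fixes A B :: "real mat"
  assumes A: "A \<in> carrier_mat r1 n" and B: "B \<in> carrier_mat r2 n"
    and x: "x \<in> carrier_vec r1" and y: "y \<in> carrier_vec r2"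
  shows "(A @\<^sub>r B)\<^sup>T *\<^sub>v (x @\<^sub>v y) = A\<^sup>T *\<^sub>v x + B\<^sup>T *\<^sub>v y"
proof (rule eq_vecI)
  fix i assume "i < dim_vec (A\<^sup>T *\<^sub>v x + B\<^sup>T *\<^sub>v y)"
  then have i: "i < n" using B by simp
  then have "((A @\<^sub>r B)\<^sup>T *\<^sub>v (x @\<^sub>v y)) $ i = col (A @\<^sub>r B) i \<bullet> (x @\<^sub>v y)"
    using carrier_append_rows[OF A B] by simp
  also have "\<dots> = col A i \<bullet> x + col B i \<bullet> y"
    unfolding col_append_rows[OF A B i]
    by (rule scalar_prod_append[of _ r1 _ r2]) (use A B x y in auto)
  also have "\<dots> = (A\<^sup>T *\<^sub>v x + B\<^sup>T *\<^sub>v y) $ i" using i A B by simp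
  finally show "((A @\<^sub>r B)\<^sup>T *\<^sub>v (x @\<^sub>v y)) $ i = (A\<^sup>T *\<^sub>v x + B\<^sup>T *\<^sub>v y) $ i" .
qed (use carrier_append_rows[OF A B] B in auto)

lemma orthonormal_cols_cancel:
  fixes Q :: "real mat"
  assumes Q: "Q \<in> carrier_mat r n" "Q\<^sup>T * Q = 1\<^sub>m n" and x: "x \<in> carrier_vec n"
  shows "Q\<^sup>T *\<^sub>v (Q *\<^sub>v x) = x"
proof -
  have "Q\<^sup>T *\<^sub>v (Q *\<^sub>v x) = (Q\<^sup>T * Q) *\<^sub>v x"
    by (rule assoc_mult_mat_vec[symmetric]) (use Q x in auto)
  then show ?thesis using Q x by simp
qed

lemma orthonormal_cols_isometry:
  fixes Q :: "real mat"
  assumes Q: "Q \<in> carrier_mat r n" "Q\<^sup>T * Q = 1\<^sub>m n" and x: "x \<in> carrier_vec n"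
  shows "vec_norm2 (Q *\<^sub>v x) = vec_norm2 x"
proof -
  have "(Q *\<^sub>v x) \<bullet> (Q *\<^sub>v x) = (Q\<^sup>T *\<^sub>v (Q *\<^sub>v x)) \<bullet> x"
    by (rule transpose_vec_mult_scalar[symmetric]) (use Q x in auto)
  then show ?thesis
    by (simp add: orthonormal_cols_cancel[OF assms] vec_norm2_def)
qed

lemma orthonormal_cols_transpose_contraction:
  fixes Q :: "real mat"
  assumes Q: "Q \<in> carrier_mat r n" "Q\<^sup>T * Q = 1\<^sub>m n" and y: "y \<in> carrier_vec r"
  shows "vec_norm2 (Q\<^sup>T *\<^sub>v y) \<le> vec_norm2 y"
proof -
  let ?x = "Q\<^sup>T *\<^sub>v y"
  have xc: "?x \<in> carrier_vec n" using Q y by auto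
  have "(vec_norm2 ?x)\<^sup>2 = y \<bullet> (Q *\<^sub>v ?x)"
    unfolding vec_norm2_square using transpose_vec_mult_scalar[OF Q(1) xc y] .
  also have "\<dots> \<le> vec_norm2 y * vec_norm2 (Q *\<^sub>v ?x)"
    using abs_scalar_prod_le[of y r "Q *\<^sub>v ?x"] Q y by auto
  also have "\<dots> = vec_norm2 y * vec_norm2 ?x"
    by (simp add: orthonormal_cols_isometry[OF Q xc])
  finally have "vec_norm2 ?x * vec_norm2 ?x \<le> vec_norm2 y * vec_norm2 ?x"
    by (simp add: power2_eq_square)
  then show ?thesis
    using vec_norm2_nonneg[of ?x] vec_norm2_nonneg[of y]
    by (cases "vec_norm2 ?x = 0") (auto simp: mult_le_cancel_right)
qed

section \<open>Bidiagonal matrices\<close>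

text \<open>For \<open>j = 0\<close> there is no superdiagonal entry; its coefficient is replaced by 0, and the then irrelevant
  index \<open>j - 1\<close> stays in range because \<open>0 - 1 = 0\<close>. All the recurrences below use this convention.\<close>

lemma sum_bidiagonal:
  fixes x :: "nat \<Rightarrow> real"
  assumes "j < k"
  shows "(\<Sum>i<k. x i * (if i = j then a else if j = i + 1 then b else 0)) =
    a * x j + (if j = 0 then 0 else b) * x (j - 1)"
proof -
  have "(\<Sum>i<k. x i * (if i = j then a else if j = i + 1 then b else 0)) =
    (\<Sum>i\<in>{j - 1, j}. x i * (if i = j then a else if j = i + 1 then b else 0))"
    by (rule sum.mono_neutral_right) (use assms in auto)
  then show ?thesis by (cases j) auto
qed

lemma B_hat_carrier: "B_hat k \<alpha>h \<beta>h \<in> carrier_mat k k"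
  by (simp add: B_hat_def)

lemma B_hat_index:
  assumes "i < k" "j < k"
  shows "B_hat k \<alpha>h \<beta>h $$ (i, j) =
    (if i = j then \<alpha>h (j + 1) else if j = i + 1 then \<beta>h j else 0)"
  using assms by (auto simp: B_hat_def)

lemma B_bar_index:
  assumes "i < k" "j < k"
  shows "B_bar k \<alpha>h \<beta>h $$ (i, j) =
    (if i = j then (- 1) ^ j * \<alpha>h (j + 1) else if j = i + 1 then (- 1) ^ j * \<beta>h j else 0)"
  using assms mat_diag_mult_right[OF B_hat_carrier, of k \<alpha>h \<beta>h "\<lambda>i. (- 1) ^ i"]
  by (simp add: B_bar_def D_mat_def B_hat_index)

lemma B_bar_carrier: "B_bar k \<alpha>h \<beta>h \<in> carrier_mat k k"
  unfolding B_bar_def D_mat_def using B_hat_carrier by (rule mult_carrier_mat) simp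

lemma B_under_carrier:
  assumes "1 \<le> k"
  shows "B_under k \<alpha> \<beta> \<in> carrier_mat k k"
proof -
  have "(B_mat (k - 1) \<alpha> \<beta>)\<^sup>T \<in> carrier_mat (k - 1) k"
    using assms by (simp add: B_mat_def)
  moreover have "mat_of_row (\<alpha> k \<cdot>\<^sub>v unit_vec k (k - 1)) \<in> carrier_mat 1 k"
    by (simp add: mat_of_row_def)
  ultimately have "B_under k \<alpha> \<beta> \<in> carrier_mat (k - 1 + 1) k"
    unfolding B_under_def by (rule carrier_append_rows)
  then show ?thesis using assms by simp
qed

lemma B_under_index:
  assumes "i < k" "j < k"
  shows "B_under k \<alpha> \<beta> $$ (i, j) =
    (if i = j then \<alpha> (j + 1) else if j = i + 1 then \<beta> (j + 1) else 0)"
proof -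
  let ?top = "(B_mat (k - 1) \<alpha> \<beta>)\<^sup>T" and ?last = "mat_of_row (\<alpha> k \<cdot>\<^sub>v unit_vec k (k - 1))"
  have k: "k - 1 + 1 = k" using assms by simp
  have "?top \<in> carrier_mat (k - 1) k" using k by (simp add: B_mat_def)
  moreover have "?last \<in> carrier_mat 1 k" by (simp add: mat_of_row_def)
  ultimately have "B_under k \<alpha> \<beta> $$ (i, j) =
    (if i < k - 1 then ?top $$ (i, j) else ?last $$ (i - (k - 1), j))"
    unfolding B_under_def using assms by (intro append_rows_index) auto
  also have "\<dots> = (if i = j then \<alpha> (j + 1) else if j = i + 1 then \<beta> (j + 1) else 0)"
  proof (cases "i < k - 1")
    case True
    then show ?thesis using assms k by (simp add: B_mat_def)
  next
    case False
    then have "i = k - 1" using assms by simp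
    then show ?thesis using assms by (auto simp: mat_of_row_def)
  qed
  finally show ?thesis .
qed

text \<open>The inverse of \<open>B_bar\<close> is that of \<open>B_hat\<close> multiplied from the left by the orthogonal matrix \<open>D_mat k\<close>.\<close>

lemma mat_norm2_inv_B_bar:
  assumes inv: "invertible_mat (B_hat k \<alpha>h \<beta>h)"
  shows "mat_norm2 (mat_inv (B_bar k \<alpha>h \<beta>h)) = mat_norm2 (mat_inv (B_hat k \<alpha>h \<beta>h))"
proof -
  let ?B = "B_hat k \<alpha>h \<beta>h" and ?D = "D_mat k" and ?Y = "mat_inv (B_hat k \<alpha>h \<beta>h)"
  note I = mat_inv_works[OF B_hat_carrier inv]
  have D: "?D \<in> carrier_mat k k" by (simp add: D_mat_def)
  have BD: "?B * ?D \<in> carrier_mat k k" by (rule mult_carrier_mat[OF B_hat_carrier D])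
  have DD: "?D * ?D = 1\<^sub>m k"
    by (simp add: D_mat_def flip: power_add mult_2)
  have "?B * ?D * (?D * ?Y) = ?B * (?D * (?D * ?Y))"
    by (rule assoc_mult_mat[of _ k k _ k _ k]) (use D I(1) B_hat_carrier in auto)
  also have "?D * (?D * ?Y) = ?D * ?D * ?Y"
    by (rule assoc_mult_mat[of _ k k _ k _ k, symmetric]) (use D I(1) in auto)
  finally have r: "?B * ?D * (?D * ?Y) = 1\<^sub>m k" using DD I by simp
  have "?D * ?Y * (?B * ?D) = ?D * (?Y * (?B * ?D))"
    by (rule assoc_mult_mat[of _ k k _ k _ k]) (use D I(1) BD in auto)
  also have "?Y * (?B * ?D) = ?Y * ?B * ?D"
    by (rule assoc_mult_mat[of _ k k _ k _ k, symmetric]) (use D I(1) B_hat_carrier in auto)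
  finally have l: "?D * ?Y * (?B * ?D) = 1\<^sub>m k" using DD D I by simp
  have eq: "mat_inv (B_bar k \<alpha>h \<beta>h) = ?D * ?Y"
    unfolding B_bar_def
    by (rule mat_inv_eqI) (use r l D I(1) BD in auto)
  have "vec_norm2 ((?D * ?Y) *\<^sub>v x) = vec_norm2 (?Y *\<^sub>v x)" if x: "x \<in> carrier_vec k" for x
  proof -
    have "(?D * ?Y) *\<^sub>v x = ?D *\<^sub>v (?Y *\<^sub>v x)"
      by (rule assoc_mult_mat_vec) (use D I(1) x in auto)
    moreover have "?D\<^sup>T = ?D" by (rule eq_matI) (auto simp: D_mat_def mat_diag_def)
    ultimately show ?thesis
      using orthonormal_cols_isometry[OF D, of "?Y *\<^sub>v x"] DD I(1) x by simp
  qed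
  then show ?thesis
    unfolding eq mat_norm2_def using D I(1) by (intro SUP_cong) auto
qed

section \<open>The computed recurrences, column by column\<close>

lemma seq_mat_carrier: "seq_mat d j w \<in> carrier_mat d j"
  by (simp add: seq_mat_def carrier_matI)

lemma seq_mat_index:
  assumes "i < d" "l < j"
  shows "seq_mat d j w $$ (i, l) = w (l + 1) $ i"
  using assms by (simp add: seq_mat_def mat_of_cols_index del: upt_Suc)

lemma col_seq_mat:
  assumes "l < j" "w (l + 1) \<in> carrier_vec d"
  shows "col (seq_mat d j w) l = w (l + 1)"
  using assms seq_mat_carrier[of d j w] by (intro eq_vecI) (auto simp: seq_mat_index)

lemma block_row_first_index:
  fixes X :: "real mat"
  assumes X: "X \<in> carrier_mat (m + p) k" and "i < m" "j < k"
  shows "((1\<^sub>m m @\<^sub>r 0\<^sub>m p m)\<^sup>T * X) $$ (i, j) = X $$ (i, j)"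
proof -
  have I: "(1\<^sub>m m @\<^sub>r 0\<^sub>m p m :: real mat) \<in> carrier_mat (m + p) m" by simp
  have "((1\<^sub>m m @\<^sub>r 0\<^sub>m p m)\<^sup>T * X) $$ (i, j) = col (1\<^sub>m m @\<^sub>r 0\<^sub>m p m) i \<bullet> col X j"
    using carrier_matD[OF I] assms by simp
  also have "col (1\<^sub>m m @\<^sub>r 0\<^sub>m p m :: real mat) i = unit_vec (m + p) i"
    using assms by (intro eq_vecI) (auto simp: append_rows_def)
  finally show ?thesis using assms by simp
qed

lemma block_row_last_index:
  fixes X :: "real mat"
  assumes X: "X \<in> carrier_mat (m + p) k" and "i < p" "j < k"
  shows "((0\<^sub>m m p @\<^sub>r 1\<^sub>m p)\<^sup>T * X) $$ (i, j) = X $$ (m + i, j)"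
proof -
  have I: "(0\<^sub>m m p @\<^sub>r 1\<^sub>m p :: real mat) \<in> carrier_mat (m + p) p" by simp
  have "((0\<^sub>m m p @\<^sub>r 1\<^sub>m p)\<^sup>T * X) $$ (i, j) = col (0\<^sub>m m p @\<^sub>r 1\<^sub>m p) i \<bullet> col X j"
    using carrier_matD[OF I] assms by simp
  also have "col (0\<^sub>m m p @\<^sub>r 1\<^sub>m p :: real mat) i = unit_vec (m + p) (m + i)"
    using assms by (intro eq_vecI) (auto simp: append_rows_def)
  finally show ?thesis using assms by simp
qed

context jbd_finite_precision
begin

abbreviation Q :: "real mat" where
  "Q \<equiv> QA @\<^sub>r QL"

abbreviation v :: "nat \<Rightarrow> real vec" where
  "v i \<equiv> Q\<^sup>T *\<^sub>v vt i"

lemma Q_orthonormal: "Q \<in> carrier_mat (m + p) n" "Q\<^sup>T * Q = 1\<^sub>m n"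
proof -
  show "Q \<in> carrier_mat (m + p) n" using QA_dim QL_dim by simp
  moreover have "A @\<^sub>r L \<in> carrier_mat (m + p) n" using A_dim L_dim by simp
  ultimately show "Q\<^sup>T * Q = 1\<^sub>m n"
    using qr_A_L unfolding compact_qr_def by (simp only: carrier_matD)
qed

lemma u_Suc: "j < k + 1 \<Longrightarrow> u (j + 1) \<in> carrier_vec m \<and> vec_norm2 (u (j + 1)) = 1"
  using u_unit[of "j + 1"] by simp

lemma vt_Suc: "j < k \<Longrightarrow> vt (j + 1) \<in> carrier_vec (m + p) \<and> vec_norm2 (vt (j + 1)) = 1"
  using vt_unit[of "j + 1"] by simp

lemma uh_Suc: "j < k \<Longrightarrow> uh (j + 1) \<in> carrier_vec p \<and> vec_norm2 (uh (j + 1)) = 1"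
  using uh_unit[of "j + 1"] by simp

lemma v_carrier: "v i \<in> carrier_vec n"
  by (rule carrier_vecI) (simp add: carrier_matD[OF Q_orthonormal(1)])

lemma recurrence_A_col:
  assumes j: "j < k"
  shows "\<exists>f \<in> carrier_vec m. vec_norm2 f \<le> C * \<epsilon> \<and>
    vec_first (vt (j + 1)) m = \<alpha> (j + 1) \<cdot>\<^sub>v u (j + 1) + \<beta> (j + 2) \<cdot>\<^sub>v u (j + 2) + f"
proof -
  obtain F where F: "F \<in> carrier_mat m k" "mat_norm2 F \<le> C * \<epsilon>" and
    eq: "(1\<^sub>m m @\<^sub>r 0\<^sub>m p m)\<^sup>T * seq_mat (m + p) k vt = seq_mat m (k + 1) u * B_mat k \<alpha> \<beta> + F"
    using recurrence_A by blast
  have "vec_first (vt (j + 1)) m = \<alpha> (j + 1) \<cdot>\<^sub>v u (j + 1) + \<beta> (j + 2) \<cdot>\<^sub>v u (j + 2) + col F j"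
  proof (rule eq_vecI)
    fix i assume "i < dim_vec (\<alpha> (j + 1) \<cdot>\<^sub>v u (j + 1) + \<beta> (j + 2) \<cdot>\<^sub>v u (j + 2) + col F j)"
    then have i: "i < m" using F by simp
    have "vt (j + 1) $ i = ((1\<^sub>m m @\<^sub>r 0\<^sub>m p m)\<^sup>T * seq_mat (m + p) k vt) $$ (i, j)"
      using block_row_first_index[OF seq_mat_carrier i j] i j by (simp add: seq_mat_index)
    also have "\<dots> = (seq_mat m (k + 1) u * B_mat k \<alpha> \<beta>) $$ (i, j) + F $$ (i, j)"
      unfolding eq using F i j by simp
    also have "(seq_mat m (k + 1) u * B_mat k \<alpha> \<beta>) $$ (i, j) =
      (\<Sum>l<k + 1. u (l + 1) $ i *
        (if l = j then \<alpha> (j + 1) else if l = j + 1 then \<beta> (j + 2) else 0))"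
      using seq_mat_carrier[of m "k + 1" u] i j
      by (auto simp: scalar_prod_def B_mat_def seq_mat_index atLeast0LessThan intro!: sum.cong)
    also have "\<dots> = (\<Sum>l\<in>{j, j + 1}. u (l + 1) $ i *
        (if l = j then \<alpha> (j + 1) else if l = j + 1 then \<beta> (j + 2) else 0))"
      by (rule sum.mono_neutral_right) (use j in auto)
    finally have "vt (j + 1) $ i = \<alpha> (j + 1) * u (j + 1) $ i + \<beta> (j + 2) * u (j + 2) $ i + F $$ (i, j)"
      by (simp add: mult.commute)
    moreover have "dim_vec (u (j + 1)) = m" "dim_vec (u (j + 2)) = m"
      using j u_Suc[of j] u_Suc[of "j + 1"] by auto
    ultimately show "vec_first (vt (j + 1)) m $ i =
      (\<alpha> (j + 1) \<cdot>\<^sub>v u (j + 1) + \<beta> (j + 2) \<cdot>\<^sub>v u (j + 2) + col F j) $ i"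
      using i j F by (simp add: vec_first_def)
  qed (use F in auto)
  then show ?thesis
    using F j vec_norm2_col_le[of j F] by (intro bexI[of _ "col F j"]) auto
qed

lemma recurrence_L_col:
  assumes j: "j < k"
  shows "\<exists>f \<in> carrier_vec p. vec_norm2 f \<le> C * \<epsilon> \<and>
    (- 1) ^ j \<cdot>\<^sub>v vec_last (vt (j + 1)) p =
      \<alpha>h (j + 1) \<cdot>\<^sub>v uh (j + 1) + (if j = 0 then 0 else \<beta>h j) \<cdot>\<^sub>v uh (j - 1 + 1) + f"
proof -
  obtain F where F: "F \<in> carrier_mat p k" "mat_norm2 F \<le> C * \<epsilon>" and
    eq: "(0\<^sub>m m p @\<^sub>r 1\<^sub>m p)\<^sup>T * seq_mat (m + p) k vt * D_mat k =
      seq_mat p k uh * B_hat k \<alpha>h \<beta>h + F"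
    using recurrence_L by blast
  have "(- 1) ^ j \<cdot>\<^sub>v vec_last (vt (j + 1)) p =
    \<alpha>h (j + 1) \<cdot>\<^sub>v uh (j + 1) + (if j = 0 then 0 else \<beta>h j) \<cdot>\<^sub>v uh (j - 1 + 1) + col F j"
    (is "_ = ?rhs")
  proof (rule eq_vecI)
    fix i assume "i < dim_vec ?rhs"
    then have i: "i < p" using F by simp
    have VL: "(0\<^sub>m m p @\<^sub>r 1\<^sub>m p)\<^sup>T * seq_mat (m + p) k vt \<in> carrier_mat p k"
      by (rule mult_carrier_mat[of _ _ "m + p"]) (auto simp: seq_mat_carrier)
    have "(- 1) ^ j * vt (j + 1) $ (m + i) =
      ((0\<^sub>m m p @\<^sub>r 1\<^sub>m p)\<^sup>T * seq_mat (m + p) k vt * D_mat k) $$ (i, j)"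
      unfolding D_mat_def mat_diag_mult_right[OF VL]
      using block_row_last_index[OF seq_mat_carrier i j] i j by (simp add: seq_mat_index)
    also have "\<dots> = (seq_mat p k uh * B_hat k \<alpha>h \<beta>h) $$ (i, j) + F $$ (i, j)"
      unfolding eq using F i j by simp
    also have "(seq_mat p k uh * B_hat k \<alpha>h \<beta>h) $$ (i, j) =
      (\<Sum>l<k. uh (l + 1) $ i *
        (if l = j then \<alpha>h (j + 1) else if j = l + 1 then \<beta>h j else 0))"
      using seq_mat_carrier[of p k uh] B_hat_carrier[of k \<alpha>h \<beta>h] i j
      by (auto simp: scalar_prod_def B_hat_index seq_mat_index atLeast0LessThan intro!: sum.cong)
    also have "\<dots> = \<alpha>h (j + 1) * uh (j + 1) $ i + (if j = 0 then 0 else \<beta>h j) * uh (j - 1 + 1) $ i"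
      by (rule sum_bidiagonal[OF j])
    finally have "(- 1) ^ j * vt (j + 1) $ (m + i) =
      \<alpha>h (j + 1) * uh (j + 1) $ i + (if j = 0 then 0 else \<beta>h j) * uh (j - 1 + 1) $ i + F $$ (i, j)" .
    moreover have "dim_vec (vt (j + 1)) = m + p" "dim_vec (uh (j + 1)) = p" "dim_vec (uh (j - 1 + 1)) = p"
      using j vt_Suc[of j] uh_Suc[of j] uh_Suc[of "j - 1"] by auto
    ultimately show "((- 1) ^ j \<cdot>\<^sub>v vec_last (vt (j + 1)) p) $ i = ?rhs $ i"
      using i j F by (simp add: vec_last_def)
  qed (use F in auto)
  then show ?thesis
    using F j vec_norm2_col_le[of j F] by (intro bexI[of _ "col F j"]) auto
qed

lemma recurrence_Q_col:
  assumes j: "j < k"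
  shows "\<exists>g \<in> carrier_vec (m + p). vec_norm2 g \<le> C * \<epsilon> \<and>
    Q *\<^sub>v (QA\<^sup>T *\<^sub>v u (j + 1)) =
      \<alpha> (j + 1) \<cdot>\<^sub>v vt (j + 1) + (if j = 0 then 0 else \<beta> (j + 1)) \<cdot>\<^sub>v vt (j - 1 + 1) + g"
proof -
  let ?U = "seq_mat m (k + 1) u @\<^sub>r 0\<^sub>m p (k + 1)"
  let ?N = "mat_of_cols (m + p) [vt (k + 1)] * mat_of_row (unit_vec (k + 1) k) :: real mat"
  obtain G where G: "G \<in> carrier_mat (m + p) (k + 1)" "mat_norm2 G \<le> C * \<epsilon>" and
    eq: "Q * Q\<^sup>T * ?U = seq_mat (m + p) k vt * (B_mat k \<alpha> \<beta>)\<^sup>T + \<alpha> (k + 1) \<cdot>\<^sub>m ?N + G"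
    using recurrence_Q by blast
  have Uc: "?U \<in> carrier_mat (m + p) (k + 1)" by (simp add: seq_mat_carrier)
  have Nc: "?N \<in> carrier_mat (m + p) (k + 1)" by (simp add: carrier_matI mat_of_row_def)
  have "Q *\<^sub>v (QA\<^sup>T *\<^sub>v u (j + 1)) = col (Q * Q\<^sup>T * ?U) j"
  proof -
    have "col ?U j = u (j + 1) @\<^sub>v 0\<^sub>v p"
      using col_append_rows[OF seq_mat_carrier zero_carrier_mat, of j "k + 1" m u p] j
        col_seq_mat[of j "k + 1" u m] u_Suc[of j] by simp
    moreover have "Q\<^sup>T *\<^sub>v (u (j + 1) @\<^sub>v 0\<^sub>v p) = QA\<^sup>T *\<^sub>v u (j + 1)"
    proof -
      have "QL\<^sup>T *\<^sub>v 0\<^sub>v p = 0\<^sub>v n" using QL_dim by (intro eq_vecI) auto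
      then show ?thesis
        using transpose_append_rows_mult_vec[OF QA_dim QL_dim, of "u (j + 1)" "0\<^sub>v p"] u_Suc[of j] j
          QA_dim by (simp add: mult_mat_vec_carrier[of _ n m])
    qed
    moreover have "col (Q * Q\<^sup>T * ?U) j = Q *\<^sub>v (Q\<^sup>T *\<^sub>v col ?U j)"
    proof -
      have "col (Q * Q\<^sup>T * ?U) j = (Q * Q\<^sup>T) *\<^sub>v col ?U j"
        by (rule col_mult2[of _ "m + p" "m + p" _ "k + 1"]) (use Uc Q_orthonormal j in auto)
      also have "\<dots> = Q *\<^sub>v (Q\<^sup>T *\<^sub>v col ?U j)"
        by (rule assoc_mult_mat_vec[OF Q_orthonormal(1), of _ "m + p"])
          (use Q_orthonormal(1) col_carrier_vec[OF _ Uc, of j] j in simp_all)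
      finally show ?thesis .
    qed
    ultimately show ?thesis by simp
  qed
  also have "\<dots> = \<alpha> (j + 1) \<cdot>\<^sub>v vt (j + 1)
      + (if j = 0 then 0 else \<beta> (j + 1)) \<cdot>\<^sub>v vt (j - 1 + 1) + col G j" (is "_ = ?rhs")
    unfolding eq
  proof (rule eq_vecI)
    fix i assume "i < dim_vec ?rhs"
    then have i: "i < m + p" using G by simp
    have Vc: "seq_mat (m + p) k vt * (B_mat k \<alpha> \<beta>)\<^sup>T \<in> carrier_mat (m + p) (k + 1)"
      by (rule mult_carrier_mat[OF seq_mat_carrier]) (simp add: B_mat_def)
    \<comment> \<open>The term with \<open>vt (k + 1)\<close> sits in the last column, number \<open>k\<close>, and \<open>j < k\<close>.\<close>
    have "?N $$ (i, j) = 0"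
      using i j by (simp add: scalar_prod_def mat_of_row_def)
    moreover have "(seq_mat (m + p) k vt * (B_mat k \<alpha> \<beta>)\<^sup>T) $$ (i, j) =
      (\<Sum>l<k. vt (l + 1) $ i *
        (if l = j then \<alpha> (j + 1) else if j = l + 1 then \<beta> (j + 1) else 0))"
      using seq_mat_carrier[of "m + p" k vt] i j
      by (auto simp: scalar_prod_def B_mat_def seq_mat_index atLeast0LessThan intro!: sum.cong)
    moreover have "\<dots> = \<alpha> (j + 1) * vt (j + 1) $ i
        + (if j = 0 then 0 else \<beta> (j + 1)) * vt (j - 1 + 1) $ i"
      by (rule sum_bidiagonal[OF j])
    moreover have "col (X + \<alpha> (k + 1) \<cdot>\<^sub>m Y + G) j $ i =
        X $$ (i, j) + \<alpha> (k + 1) * Y $$ (i, j) + G $$ (i, j)"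
      if "X \<in> carrier_mat (m + p) (k + 1)" "Y \<in> carrier_mat (m + p) (k + 1)" for X Y
      using that i j G(1) by simp
    note this[OF Vc Nc]
    moreover have "dim_vec (vt (j + 1)) = m + p" "dim_vec (vt (j - 1 + 1)) = m + p"
      using j vt_Suc[of j] vt_Suc[of "j - 1"] by auto
    ultimately show "col (seq_mat (m + p) k vt * (B_mat k \<alpha> \<beta>)\<^sup>T + \<alpha> (k + 1) \<cdot>\<^sub>m ?N + G) j $ i
        = ?rhs $ i"
      using i j G by simp
  qed (use G in auto)
  finally show ?thesis
    using G(2) j vec_norm2_col_le[of j G] carrier_matD(2)[OF G(1)] col_carrier_vec[OF _ G(1), of j]
    by (intro bexI[of _ "col G j"] conjI) auto
qed

end

section \<open>Coefficient bounds for small roundoff\<close>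

lemma scalar_prod_first_last:
  fixes x y :: "real vec"
  assumes "x \<in> carrier_vec (m + p)" "y \<in> carrier_vec (m + p)"
  shows "x \<bullet> y = vec_first x m \<bullet> vec_first y m + vec_last x p \<bullet> vec_last y p"
  using scalar_prod_append[of "vec_first x m" m "vec_last x p" p "vec_first y m" "vec_last y p"]
    vec_first_last_append[OF assms(1)] vec_first_last_append[OF assms(2)]
  by simp

lemma scalar_prod_self_nonneg:
  fixes x :: "real vec"
  shows "0 \<le> x \<bullet> x"
  using vec_norm2_square[of x] zero_le_power2[of "vec_norm2 x"] by simp

lemma vec_norm2_le_1_iff: "vec_norm2 x \<le> 1 \<longleftrightarrow> x \<bullet> x \<le> 1"
  by (simp add: vec_norm2_def)

text \<open>This is the identity behind \<open>B\<^sup>TB + B'\<^sup>TB' = I\<close> for the two bidiagonal matrices of the process,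
  read in one column and tested against one vector: \<open>y\<close>, \<open>r\<close>, \<open>q\<close> stand for the products of the test
  vector with \<open>v\<close>, \<open>Q\<^sub>A\<^sup>T u\<close>, \<open>Q\<^sub>L\<^sup>T uh\<close>, the suffixes \<open>p\<close> and \<open>n\<close> for the previous and the next index,
  and \<open>e1\<close>, \<open>e2\<close>, \<open>e3\<close> for rounding errors. The relative errors \<open>\<rho>\<close> of the computed
  superdiagonal enter linearly.\<close>

lemma bidiagonal_residual_identity:
  fixes y :: real
  assumes split: "y = A * r + B * rn + \<sigma> * (a * q + b * qp) + e1"
    and r: "r = A * y + Bp * yp + e2" and rn: "rn = An * yn + B * y + e3"
    and \<sigma>: "\<sigma> * \<sigma> = 1"
    and prev: "b * ap = A * Bp * (1 + \<rho>)" and "next": "a * bn = An * B * (1 + \<rho>n)"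
  shows "\<sigma> * (a * (q - \<sigma> * (a * y - bn * yn)) + b * (qp + \<sigma> * (ap * yp - b * y))) =
    (1 - (A\<^sup>2 + B\<^sup>2 + (a\<^sup>2 + b\<^sup>2))) * y + A * Bp * \<rho> * yp + An * B * \<rho>n * yn - A * e2 - B * e3 - e1"
proof -
  have "\<sigma> * (a * (q - \<sigma> * (a * y - bn * yn)) + b * (qp + \<sigma> * (ap * yp - b * y))) =
    \<sigma> * (a * q + b * qp) - (\<sigma> * \<sigma>) * (a\<^sup>2 * y - (a * bn) * yn - (b * ap) * yp + b\<^sup>2 * y)"
    by (simp add: algebra_simps power2_eq_square)
  also have "\<sigma> * (a * q + b * qp) = y - A * (A * y + Bp * yp + e2) - B * (An * yn + B * y + e3) - e1"
    using split r rn by simp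
  finally show ?thesis
    unfolding \<sigma> prev "next" by (simp add: algebra_simps power2_eq_square)
qed

text \<open>The two thresholds depend on \<open>C\<close> only. The local orthogonality errors \<open>C * c1 * \<epsilon>\<close> and \<open>C * c2 * \<epsilon>\<close>
  are then small as well, since \<open>\<theta>\<close> below controls \<open>c3 * \<epsilon>\<close>.\<close>

locale jbd_small_roundoff = jbd_finite_precision +
  assumes k_pos: "1 \<le> k" and C_pos: "0 < C" and c_ge_1: "1 \<le> c1" "1 \<le> c2"
    and eps_small: "C * \<epsilon> \<le> 1 / 8"
    and theta_small: "2 * C * (c4 c1 c2 k \<alpha> \<beta> \<alpha>h \<beta>h * \<epsilon>) \<le> 1 / 8"
begin

abbreviation \<theta> :: real where
  "\<theta> \<equiv> c4 c1 c2 k \<alpha> \<beta> \<alpha>h \<beta>h * \<epsilon>"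

abbreviation b :: "nat \<Rightarrow> real" where
  "b j \<equiv> if j = 0 then 0 else \<beta>h j"

lemma B_hat_sum:
  assumes "j < k"
  shows "(\<Sum>i<k. x i * B_hat k \<alpha>h \<beta>h $$ (i, j)) = \<alpha>h (j + 1) * x j + b j * x (j - 1)"
proof -
  have "(\<Sum>i<k. x i * B_hat k \<alpha>h \<beta>h $$ (i, j)) =
    (\<Sum>i<k. x i * (if i = j then \<alpha>h (j + 1) else if j = i + 1 then \<beta>h j else 0))"
    using assms by (intro sum.cong) (auto simp: B_hat_index)
  then show ?thesis using sum_bidiagonal[OF assms] by simp
qed

lemma B_under_sum:
  assumes "j < k"
  shows "(\<Sum>i<k. x i * B_under k \<alpha> \<beta> $$ (i, j)) =
    \<alpha> (j + 1) * x j + (if j = 0 then 0 else \<beta> (j + 1)) * x (j - 1)"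
proof -
  have "(\<Sum>i<k. x i * B_under k \<alpha> \<beta> $$ (i, j)) =
    (\<Sum>i<k. x i * (if i = j then \<alpha> (j + 1) else if j = i + 1 then \<beta> (j + 1) else 0))"
    using assms by (intro sum.cong) (auto simp: B_under_index)
  then show ?thesis using sum_bidiagonal[OF assms] by simp
qed

lemma vt_parts:
  assumes "j < k"
  shows "vec_first (vt (j + 1)) m \<bullet> vec_first (vt (j + 1)) m
      + vec_last (vt (j + 1)) p \<bullet> vec_last (vt (j + 1)) p = 1"
    and "vec_norm2 (vec_first (vt (j + 1)) m) \<le> 1" "vec_norm2 (vec_last (vt (j + 1)) p) \<le> 1"
proof -
  show *: "vec_first (vt (j + 1)) m \<bullet> vec_first (vt (j + 1)) m
      + vec_last (vt (j + 1)) p \<bullet> vec_last (vt (j + 1)) p = 1"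
    using scalar_prod_first_last[of "vt (j + 1)" m p "vt (j + 1)"] vt_Suc[OF assms]
    by (simp add: vec_norm2_eq_1_iff)
  show "vec_norm2 (vec_first (vt (j + 1)) m) \<le> 1" "vec_norm2 (vec_last (vt (j + 1)) p) \<le> 1"
    using * scalar_prod_self_nonneg[of "vec_first (vt (j + 1)) m"]
      scalar_prod_self_nonneg[of "vec_last (vt (j + 1)) p"]
    unfolding vec_norm2_le_1_iff by linarith+
qed

lemma lower_coefficients:
  assumes j: "j < k" and \<gamma>: "0 \<le> \<gamma>" "\<gamma> \<le> 1 / 8"
    and loc: "j \<noteq> 0 \<Longrightarrow> \<alpha>h (j + 1) * \<bar>uh (j + 1) \<bullet> uh j\<bar> \<le> \<gamma>"
  shows "\<bar>\<alpha>h (j + 1)\<bar> \<le> 2" "\<bar>b j\<bar> \<le> 2"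
    "\<bar>(\<alpha>h (j + 1))\<^sup>2 + (b j)\<^sup>2 - vec_last (vt (j + 1)) p \<bullet> vec_last (vt (j + 1)) p\<bar>
      \<le> 3 * (C * \<epsilon>) + 4 * \<gamma>"
proof -
  obtain f where f: "f \<in> carrier_vec p" "vec_norm2 f \<le> C * \<epsilon>" and
    x: "(- 1) ^ j \<cdot>\<^sub>v vec_last (vt (j + 1)) p =
      \<alpha>h (j + 1) \<cdot>\<^sub>v uh (j + 1) + b j \<cdot>\<^sub>v uh (j - 1 + 1) + f"
    using recurrence_L_col[OF j] by blast
  let ?x = "(- 1) ^ j \<cdot>\<^sub>v vec_last (vt (j + 1)) p"
  have uc: "uh (j + 1) \<in> carrier_vec p" "uh (j - 1 + 1) \<in> carrier_vec p"
    and un: "vec_norm2 (uh (j + 1)) = 1" "vec_norm2 (uh (j - 1 + 1)) = 1"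
    using uh_Suc[OF j] uh_Suc[of "j - 1"] j by auto
  have x': "?x = b j \<cdot>\<^sub>v uh (j - 1 + 1) + \<alpha>h (j + 1) \<cdot>\<^sub>v uh (j + 1) + f"
    unfolding x using uc by (subst comm_add_vec[of _ p]) auto
  have xc: "?x \<in> carrier_vec p" by simp
  have xn: "vec_norm2 ?x \<le> 1" using vt_parts(3)[OF j] by (simp add: vec_norm2_smult)
  have xx: "?x \<bullet> ?x = vec_last (vt (j + 1)) p \<bullet> vec_last (vt (j + 1)) p"
    by (simp flip: power_add mult_2 mult.assoc)
  have loc': "\<bar>b j * \<alpha>h (j + 1) * (uh (j - 1 + 1) \<bullet> uh (j + 1))\<bar> \<le> \<bar>b j\<bar> * \<gamma>"
  proof (cases "j = 0")
    case False
    have "\<bar>\<alpha>h (j + 1) * (uh (j - 1 + 1) \<bullet> uh (j + 1))\<bar> \<le> \<gamma>"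
      using loc[OF False] False \<alpha>h_pos[of "j + 1"] j
        comm_scalar_prod[OF uc] by (simp add: abs_mult)
    then have "\<bar>b j\<bar> * \<bar>\<alpha>h (j + 1) * (uh (j - 1 + 1) \<bullet> uh (j + 1))\<bar> \<le> \<bar>b j\<bar> * \<gamma>"
      by (intro mult_left_mono) auto
    then show ?thesis by (simp only: abs_mult mult.assoc)
  qed simp
  note comb = combination_of_two_unit_vectors[OF x' xc xn uc(2) un(2) uc(1) un(1) f loc' eps_small \<gamma>]
  show "\<bar>\<alpha>h (j + 1)\<bar> \<le> 2" "\<bar>b j\<bar> \<le> 2"
    "\<bar>(\<alpha>h (j + 1))\<^sup>2 + (b j)\<^sup>2 - vec_last (vt (j + 1)) p \<bullet> vec_last (vt (j + 1)) p\<bar>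
      \<le> 3 * (C * \<epsilon>) + 4 * \<gamma>"
    using comb unfolding xx by (simp_all only: add.commute)
qed

text \<open>All the error bounds below are proportional to \<open>\<theta>\<close>. They can be so only because the inverse of
  \<open>B_hat\<close> is not small, which in turn holds because its first diagonal entry is not large.\<close>

lemma inv_B_hat_ge_half: "1 / 2 \<le> mat_norm2 (mat_inv (B_hat k \<alpha>h \<beta>h))"
proof -
  let ?B = "B_hat k \<alpha>h \<beta>h" and ?Y = "mat_inv (B_hat k \<alpha>h \<beta>h)"
  note I = mat_inv_works[OF B_hat_carrier B_hat_invertible]
  have k0: "0 < k" using k_pos by simp
  have "(?Y * ?B) $$ (0, 0) = (\<Sum>i<k. ?Y $$ (0, i) * ?B $$ (i, 0))"
    using I(1) B_hat_carrier[of k \<alpha>h \<beta>h] k0 by (simp add: scalar_prod_def atLeast0LessThan)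
  also have "\<dots> = \<alpha>h 1 * ?Y $$ (0, 0)" unfolding B_hat_sum[OF k0] by simp
  finally have one: "\<alpha>h 1 * ?Y $$ (0, 0) = 1" using I(3) k0 by simp
  have "\<bar>\<alpha>h 1\<bar> \<le> 2" using lower_coefficients(1)[OF k0, of 0] by simp
  moreover have "\<bar>?Y $$ (0, 0)\<bar> \<le> mat_norm2 ?Y"
    using abs_mat_index_le_norm2[of 0 ?Y 0] I(1) k0 by auto
  ultimately have "\<bar>\<alpha>h 1\<bar> * \<bar>?Y $$ (0, 0)\<bar> \<le> 2 * mat_norm2 ?Y"
    by (intro mult_mono) auto
  then show ?thesis using one by (simp flip: abs_mult)
qed

lemma theta_bounds:
  shows "mat_norm2 (mat_inv (B_under k \<alpha> \<beta>)) * \<epsilon> \<le> \<theta>"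
    "c3 c1 c2 * \<epsilon> * mat_norm2 (mat_inv (B_hat k \<alpha>h \<beta>h)) \<le> \<theta>"
    "\<epsilon> \<le> \<theta>" "c3 c1 c2 * \<epsilon> \<le> 2 * \<theta>"
proof -
  let ?u = "mat_norm2 (mat_inv (B_under k \<alpha> \<beta>))" and ?h = "mat_norm2 (mat_inv (B_hat k \<alpha>h \<beta>h))"
  have c3: "2 \<le> c3 c1 c2" using c_ge_1 by (simp add: c3_def)
  have \<theta>: "\<theta> = ?u * \<epsilon> + c3 c1 c2 * \<epsilon> * ?h" by (simp add: c4_def algebra_simps)
  have nn: "0 \<le> ?u * \<epsilon>" "0 \<le> c3 c1 c2 * \<epsilon> * ?h"
    using mat_norm2_nonneg eps_pos c3 by auto
  show "?u * \<epsilon> \<le> \<theta>" "c3 c1 c2 * \<epsilon> * ?h \<le> \<theta>" using \<theta> nn by linarith+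
  have "c3 c1 c2 * \<epsilon> * (1 / 2) \<le> c3 c1 c2 * \<epsilon> * ?h"
    using inv_B_hat_ge_half eps_pos c3 by (intro mult_left_mono) auto
  then show "c3 c1 c2 * \<epsilon> \<le> 2 * \<theta>" using \<theta> nn by linarith
  moreover have "2 * \<epsilon> \<le> c3 c1 c2 * \<epsilon>" using c3 eps_pos by (intro mult_right_mono) auto
  ultimately show "\<epsilon> \<le> \<theta>" by linarith
qed

lemma local_orthogonality_small:
  "0 \<le> C * c1 * \<epsilon>" "C * c1 * \<epsilon> \<le> 1 / 8" "0 \<le> C * c2 * \<epsilon>" "C * c2 * \<epsilon> \<le> 1 / 8"
proof -
  show nn: "0 \<le> C * c1 * \<epsilon>" "0 \<le> C * c2 * \<epsilon>" using C_pos c_ge_1 eps_pos by auto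
  have "C * (c3 c1 c2 * \<epsilon>) \<le> C * (2 * \<theta>)" using theta_bounds(4) C_pos by (intro mult_left_mono) auto
  then have "C * c1 * \<epsilon> + C * c2 * \<epsilon> \<le> 1 / 8"
    using theta_small by (simp add: c3_def algebra_simps)
  then show "C * c1 * \<epsilon> \<le> 1 / 8" "C * c2 * \<epsilon> \<le> 1 / 8" using nn by linarith+
qed

text \<open>The unit vector \<open>vt (j + 1)\<close> consists of an upper part, which is a combination of two of the \<open>u\<close>, and
  a lower part, which is a combination of two of the \<open>uh\<close>. Hence the sum of the squares of all four
  coefficients is nearly 1. This is the diagonal of the identity \<open>B\<^sup>TB + B'\<^sup>TB' = I\<close>.\<close>

lemma coefficient_bounds:
  assumes j: "j < k"
  shows "\<bar>\<alpha> (j + 1)\<bar> \<le> 2" "\<bar>\<beta> (j + 2)\<bar> \<le> 2" "\<bar>\<alpha>h (j + 1)\<bar> \<le> 2" "\<bar>b j\<bar> \<le> 2"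
    "\<bar>(\<alpha> (j + 1))\<^sup>2 + (\<beta> (j + 2))\<^sup>2 + ((\<alpha>h (j + 1))\<^sup>2 + (b j)\<^sup>2) - 1\<bar> \<le> 7 * (C * (c3 c1 c2 * \<epsilon>))"
proof -
  obtain f where f: "f \<in> carrier_vec m" "vec_norm2 f \<le> C * \<epsilon>" and
    x: "vec_first (vt (j + 1)) m = \<alpha> (j + 1) \<cdot>\<^sub>v u (j + 1) + \<beta> (j + 2) \<cdot>\<^sub>v u (j + 2) + f"
    using recurrence_A_col[OF j] by blast
  have uc: "u (j + 1) \<in> carrier_vec m" "u (j + 2) \<in> carrier_vec m"
    and un: "vec_norm2 (u (j + 1)) = 1" "vec_norm2 (u (j + 2)) = 1"
    using u_Suc[of j] u_Suc[of "j + 1"] j by auto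
  have "\<beta> (j + 2) * \<bar>u (j + 1) \<bullet> u (j + 2)\<bar> \<le> C * c1 * \<epsilon>"
    using local_orth_u[of "j + 1"] j comm_scalar_prod[OF uc] by simp
  then have "\<bar>\<beta> (j + 2) * (u (j + 1) \<bullet> u (j + 2))\<bar> \<le> C * c1 * \<epsilon>"
    using \<beta>_pos[of "j + 2"] j by (simp add: abs_mult)
  then have "\<bar>\<alpha> (j + 1)\<bar> * \<bar>\<beta> (j + 2) * (u (j + 1) \<bullet> u (j + 2))\<bar> \<le> \<bar>\<alpha> (j + 1)\<bar> * (C * c1 * \<epsilon>)"
    by (intro mult_left_mono) auto
  then have loc: "\<bar>\<alpha> (j + 1) * \<beta> (j + 2) * (u (j + 1) \<bullet> u (j + 2))\<bar> \<le> \<bar>\<alpha> (j + 1)\<bar> * (C * c1 * \<epsilon>)"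
    by (simp only: abs_mult mult.assoc)
  note up = combination_of_two_unit_vectors[OF x vec_first_carrier vt_parts(2)[OF j] uc(1) un(1)
      uc(2) un(2) f loc eps_small local_orthogonality_small(1,2)]
  have "\<alpha>h (j + 1) * \<bar>uh (j + 1) \<bullet> uh j\<bar> \<le> C * c2 * \<epsilon>" if "j \<noteq> 0"
    using local_orth_uh[of j] that j by simp
  note low = lower_coefficients[OF j local_orthogonality_small(3,4) this]
  show "\<bar>\<alpha> (j + 1)\<bar> \<le> 2" "\<bar>\<beta> (j + 2)\<bar> \<le> 2" by (fact up(1,2))+
  show "\<bar>\<alpha>h (j + 1)\<bar> \<le> 2" "\<bar>b j\<bar> \<le> 2" using low(1,2) by auto
  have "2 * (C * \<epsilon>) \<le> C * (c3 c1 c2 * \<epsilon>)"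
    using mult_right_mono[of 2 "c3 c1 c2" "C * \<epsilon>"] c_ge_1 C_pos eps_pos
    by (simp add: c3_def mult_ac)
  moreover have "C * (c3 c1 c2 * \<epsilon>) = C * c1 * \<epsilon> + C * c2 * \<epsilon>"
    by (simp add: c3_def algebra_simps)
  ultimately show "\<bar>(\<alpha> (j + 1))\<^sup>2 + (\<beta> (j + 2))\<^sup>2 + ((\<alpha>h (j + 1))\<^sup>2 + (b j)\<^sup>2) - 1\<bar>
      \<le> 7 * (C * (c3 c1 c2 * \<epsilon>))"
    using up(3) low(3) vt_parts(1)[OF j] by linarith
qed

end

section \<open>The forward and the adjoint relation\<close>

lemma abs_mult_le:
  fixes x y :: real
  assumes "\<bar>x\<bar> \<le> a" "\<bar>y\<bar> \<le> c"
  shows "\<bar>x * y\<bar> \<le> a * c"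
  unfolding abs_mult by (rule mult_mono) (use assms in auto)

lemma sign_cancel: "(- 1) ^ j * ((- 1) ^ j * x) = (x :: real)"
  by (simp flip: power_add mult_2 mult.assoc)

context jbd_small_roundoff
begin

lemma Q_split:
  assumes x: "x \<in> carrier_vec (m + p)" and w: "w \<in> carrier_vec n"
  shows "x \<bullet> (Q *\<^sub>v w) = vec_first x m \<bullet> (QA *\<^sub>v w) + vec_last x p \<bullet> (QL *\<^sub>v w)"
proof -
  have "(vec_first x m @\<^sub>v vec_last x p) \<bullet> ((QA *\<^sub>v w) @\<^sub>v (QL *\<^sub>v w)) =
    vec_first x m \<bullet> (QA *\<^sub>v w) + vec_last x p \<bullet> (QL *\<^sub>v w)"
    by (rule scalar_prod_append[of _ m _ p]) (use QA_dim QL_dim w in auto)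
  then show ?thesis
    using vec_first_last_append[OF x] mat_mult_append[OF QA_dim QL_dim w] by simp
qed

lemma Q_parts_norm:
  assumes w: "w \<in> carrier_vec n" "vec_norm2 w \<le> 1"
  shows "vec_norm2 (Q *\<^sub>v w) \<le> 1" "vec_norm2 (QA *\<^sub>v w) \<le> 1" "vec_norm2 (QL *\<^sub>v w) \<le> 1"
proof -
  show Q1: "vec_norm2 (Q *\<^sub>v w) \<le> 1"
    using orthonormal_cols_isometry[OF Q_orthonormal w(1)] w(2) by simp
  have "(Q *\<^sub>v w) \<bullet> (Q *\<^sub>v w) = (QA *\<^sub>v w) \<bullet> (QA *\<^sub>v w) + (QL *\<^sub>v w) \<bullet> (QL *\<^sub>v w)"
    unfolding mat_mult_append[OF QA_dim QL_dim w(1)]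
    by (rule scalar_prod_append[of _ m _ p]) (use QA_dim QL_dim w in auto)
  then show "vec_norm2 (QA *\<^sub>v w) \<le> 1" "vec_norm2 (QL *\<^sub>v w) \<le> 1"
    using Q1 scalar_prod_self_nonneg[of "QA *\<^sub>v w"] scalar_prod_self_nonneg[of "QL *\<^sub>v w"]
    unfolding vec_norm2_le_1_iff by linarith+
qed

lemma v_scalar_prod:
  assumes "j < k" "w \<in> carrier_vec n"
  shows "v (j + 1) \<bullet> w = vt (j + 1) \<bullet> (Q *\<^sub>v w)"
  by (rule transpose_vec_mult_scalar[OF Q_orthonormal(1)]) (use assms vt_Suc in auto)

text \<open>The computed vectors \<open>vt\<close> leave the range of \<open>Q\<close> only slightly: the inner solves return
  vectors in that range, so the components of the \<open>vt\<close> orthogonal to it satisfy a homogeneous recurrence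
  with matrix \<open>B_under\<close>, up to the rounding errors.\<close>

lemma vt_near_range_Q:
  assumes w: "w \<in> carrier_vec (m + p)" "vec_norm2 w \<le> 1" and j: "j < k"
  shows "\<bar>(Q\<^sup>T *\<^sub>v w) \<bullet> v (j + 1) - w \<bullet> vt (j + 1)\<bar> \<le> 2 * real k * C * \<theta>"
proof -
  let ?h = "Q\<^sup>T *\<^sub>v w"
  have hc: "?h \<in> carrier_vec n" by (rule carrier_vecI) (simp add: carrier_matD[OF Q_orthonormal(1)])
  have Qh: "Q *\<^sub>v ?h \<in> carrier_vec (m + p)" using Q_orthonormal(1) hc by auto
  have hn: "vec_norm2 ?h \<le> 1"
    using orthonormal_cols_transpose_contraction[OF Q_orthonormal w(1)] w(2) by simp
  define x where "x i = (Q *\<^sub>v ?h) \<bullet> vt (i + 1) - w \<bullet> vt (i + 1)" for i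
  have res: "\<bar>\<Sum>i<k. x i * B_under k \<alpha> \<beta> $$ (i, j)\<bar> \<le> 2 * (C * \<epsilon>)" if j: "j < k" for j
  proof -
    obtain g where g: "g \<in> carrier_vec (m + p)" "vec_norm2 g \<le> C * \<epsilon>" and
      eq: "Q *\<^sub>v (QA\<^sup>T *\<^sub>v u (j + 1)) =
        \<alpha> (j + 1) \<cdot>\<^sub>v vt (j + 1) + (if j = 0 then 0 else \<beta> (j + 1)) \<cdot>\<^sub>v vt (j - 1 + 1) + g"
      using recurrence_Q_col[OF j] by blast
    let ?s = "QA\<^sup>T *\<^sub>v u (j + 1)"
    have sc: "?s \<in> carrier_vec n" by (rule carrier_vecI) (simp add: carrier_matD[OF QA_dim])
    have vc: "vt (j + 1) \<in> carrier_vec (m + p)" "vt (j - 1 + 1) \<in> carrier_vec (m + p)"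
      using vt_Suc[of j] vt_Suc[of "j - 1"] j by auto
    have lin: "z \<bullet> (Q *\<^sub>v ?s) = \<alpha> (j + 1) * (z \<bullet> vt (j + 1))
        + (if j = 0 then 0 else \<beta> (j + 1)) * (z \<bullet> vt (j - 1 + 1)) + z \<bullet> g"
      if "z \<in> carrier_vec (m + p)" for z
      unfolding eq using that vc g(1) by (simp add: scalar_prod_add_distrib[of _ "m + p"])
    have "(Q *\<^sub>v ?h) \<bullet> (Q *\<^sub>v ?s) = (Q\<^sup>T *\<^sub>v (Q *\<^sub>v ?h)) \<bullet> ?s"
      by (rule transpose_vec_mult_scalar[OF Q_orthonormal(1) sc Qh, symmetric])
    also have "\<dots> = w \<bullet> (Q *\<^sub>v ?s)"
      unfolding orthonormal_cols_cancel[OF Q_orthonormal hc]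
      by (rule transpose_vec_mult_scalar[OF Q_orthonormal(1) sc w(1)])
    finally have "(\<Sum>i<k. x i * B_under k \<alpha> \<beta> $$ (i, j)) = w \<bullet> g - (Q *\<^sub>v ?h) \<bullet> g"
      using lin[OF Qh] lin[OF w(1)] unfolding B_under_sum[OF j] x_def by (simp add: algebra_simps)
    moreover have "\<bar>w \<bullet> g\<bar> \<le> C * \<epsilon>" by (rule abs_scalar_prod_le_bound[OF w(1) g(1) w(2) g(2)])
    moreover have "\<bar>(Q *\<^sub>v ?h) \<bullet> g\<bar> \<le> C * \<epsilon>"
      by (rule abs_scalar_prod_le_bound[OF Qh g(1) Q_parts_norm(1)[OF hc hn] g(2)])
    ultimately show ?thesis by linarith
  qed
  have "\<bar>x j\<bar> \<le> real k * (2 * (C * \<epsilon>)) * mat_norm2 (mat_inv (B_under k \<alpha> \<beta>))"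
    by (rule left_solve_bound[OF B_under_carrier[OF k_pos] B_under_invertible res j])
  also have "\<dots> = 2 * real k * C * (mat_norm2 (mat_inv (B_under k \<alpha> \<beta>)) * \<epsilon>)" by simp
  also have "\<dots> \<le> 2 * real k * C * \<theta>"
    using theta_bounds(1) C_pos by (intro mult_left_mono) auto
  finally have "\<bar>x j\<bar> \<le> 2 * real k * C * \<theta>" .
  moreover have "(Q *\<^sub>v ?h) \<bullet> vt (j + 1) = ?h \<bullet> v (j + 1)"
    using v_scalar_prod[OF j hc] comm_scalar_prod[OF hc v_carrier] comm_scalar_prod[OF Qh] vt_Suc[OF j]
    by simp
  ultimately show ?thesis by (simp add: x_def)
qed

lemma v_gram_diagonal:
  assumes j: "j < k"
  shows "vec_norm2 (v (j + 1)) \<le> 1" "\<bar>v (j + 1) \<bullet> v (j + 1) - 1\<bar> \<le> 2 * real k * C * \<theta>"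
proof -
  show "vec_norm2 (v (j + 1)) \<le> 1"
    using orthonormal_cols_transpose_contraction[OF Q_orthonormal, of "vt (j + 1)"] vt_Suc[OF j] by simp
  have "vt (j + 1) \<bullet> vt (j + 1) = 1" using vt_Suc[OF j] by (simp add: vec_norm2_eq_1_iff)
  then show "\<bar>v (j + 1) \<bullet> v (j + 1) - 1\<bar> \<le> 2 * real k * C * \<theta>"
    using vt_near_range_Q[of "vt (j + 1)" j] vt_Suc[OF j] j by simp
qed

text \<open>The forward relation: \<open>QL v\<close> is the lower part of \<open>Q Q\<^sup>T vt\<close>, hence close to the lower part of \<open>vt\<close>,
  which the computed recurrence expresses by the \<open>uh\<close>.\<close>

lemma QL_v_relation:
  assumes w: "w \<in> carrier_vec p" "vec_norm2 w \<le> 1" and j: "j < k"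
  shows "\<bar>w \<bullet> (QL *\<^sub>v v (j + 1)) -
    (- 1) ^ j * (\<alpha>h (j + 1) * (w \<bullet> uh (j + 1)) + b j * (w \<bullet> uh (j - 1 + 1)))\<bar> \<le> 3 * real k * C * \<theta>"
proof -
  let ?z = "0\<^sub>v m @\<^sub>v w"
  have zc: "?z \<in> carrier_vec (m + p)" using w by simp
  have "?z \<bullet> ?z = w \<bullet> w"
    using scalar_prod_append[of "0\<^sub>v m" m w p "0\<^sub>v m" w] w by simp
  then have zn: "vec_norm2 ?z \<le> 1" using w(2) by (simp add: vec_norm2_def)
  have QAz: "QA\<^sup>T *\<^sub>v 0\<^sub>v m = 0\<^sub>v n" using QA_dim by (intro eq_vecI) auto
  have "Q\<^sup>T *\<^sub>v ?z = QL\<^sup>T *\<^sub>v w"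
    unfolding transpose_append_rows_mult_vec[OF QA_dim QL_dim zero_carrier_vec w(1)] QAz
    by (rule left_zero_vec[of _ n]) (rule carrier_vecI, simp add: carrier_matD[OF QL_dim])
  then have "(Q\<^sup>T *\<^sub>v ?z) \<bullet> v (j + 1) = w \<bullet> (QL *\<^sub>v v (j + 1))"
    using transpose_vec_mult_scalar[OF QL_dim v_carrier w(1)] by simp
  moreover have "?z \<bullet> vt (j + 1) = w \<bullet> vec_last (vt (j + 1)) p"
    using scalar_prod_append[of "0\<^sub>v m" m w p "vec_first (vt (j + 1)) m" "vec_last (vt (j + 1)) p"]
      vec_first_last_append[of "vt (j + 1)" m p] vt_Suc[OF j] w by simp
  ultimately have 1: "\<bar>w \<bullet> (QL *\<^sub>v v (j + 1)) - w \<bullet> vec_last (vt (j + 1)) p\<bar> \<le> 2 * real k * C * \<theta>"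
    using vt_near_range_Q[OF zc zn j] by simp
  obtain f where f: "f \<in> carrier_vec p" "vec_norm2 f \<le> C * \<epsilon>" and
    x: "(- 1) ^ j \<cdot>\<^sub>v vec_last (vt (j + 1)) p =
      \<alpha>h (j + 1) \<cdot>\<^sub>v uh (j + 1) + b j \<cdot>\<^sub>v uh (j - 1 + 1) + f"
    using recurrence_L_col[OF j] by blast
  have uc: "uh (j + 1) \<in> carrier_vec p" "uh (j - 1 + 1) \<in> carrier_vec p"
    using uh_Suc[OF j] uh_Suc[of "j - 1"] j by auto
  have "(- 1) ^ j * (w \<bullet> vec_last (vt (j + 1)) p) = w \<bullet> ((- 1) ^ j \<cdot>\<^sub>v vec_last (vt (j + 1)) p)"
    using w by simp
  also have "\<dots> = \<alpha>h (j + 1) * (w \<bullet> uh (j + 1)) + b j * (w \<bullet> uh (j - 1 + 1)) + w \<bullet> f"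
    unfolding x using uc f(1) w(1) by (simp add: scalar_prod_add_distrib[of _ p])
  finally have "(- 1) ^ j * ((- 1) ^ j * (w \<bullet> vec_last (vt (j + 1)) p)) =
    (- 1) ^ j * (\<alpha>h (j + 1) * (w \<bullet> uh (j + 1)) + b j * (w \<bullet> uh (j - 1 + 1)) + w \<bullet> f)"
    by (rule arg_cong)
  then have 2: "w \<bullet> vec_last (vt (j + 1)) p =
    (- 1) ^ j * (\<alpha>h (j + 1) * (w \<bullet> uh (j + 1)) + b j * (w \<bullet> uh (j - 1 + 1))) + (- 1) ^ j * (w \<bullet> f)"
    by (simp only: sign_cancel distrib_left)
  have "\<bar>w \<bullet> f\<bar> \<le> C * \<epsilon>" by (rule abs_scalar_prod_le_bound[OF w(1) f(1) w(2) f(2)])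
  also have "\<dots> \<le> C * \<theta>" using theta_bounds(3) C_pos by simp
  also have "\<dots> \<le> real k * (C * \<theta>)"
    using mult_right_mono[of 1 "real k" "C * \<theta>"] k_pos C_pos theta_bounds(3) eps_pos by simp
  finally have "\<bar>(- 1) ^ j * (w \<bullet> f)\<bar> \<le> real k * (C * \<theta>)" by (simp add: abs_mult)
  then show ?thesis using 1 unfolding 2 by linarith
qed

text \<open>Since \<open>Q\<^sup>T Q = I\<close>, the vector \<open>QA\<^sup>T u\<close> is recovered from the result \<open>Q QA\<^sup>T u\<close> of the inner solve
  with only the rounding error of that solve, whereas passing from \<open>vt\<close> to the range of \<open>Q\<close> would cost \<open>\<theta>\<close>.\<close>

lemma u_QA_relation:
  assumes w: "w \<in> carrier_vec n" "vec_norm2 w \<le> 1" and j: "j < k"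
  shows "\<bar>u (j + 1) \<bullet> (QA *\<^sub>v w) - (\<alpha> (j + 1) * (v (j + 1) \<bullet> w)
    + (if j = 0 then 0 else \<beta> (j + 1)) * (v (j - 1 + 1) \<bullet> w))\<bar> \<le> C * \<epsilon>"
proof -
  obtain g where g: "g \<in> carrier_vec (m + p)" "vec_norm2 g \<le> C * \<epsilon>" and
    eq: "Q *\<^sub>v (QA\<^sup>T *\<^sub>v u (j + 1)) =
      \<alpha> (j + 1) \<cdot>\<^sub>v vt (j + 1) + (if j = 0 then 0 else \<beta> (j + 1)) \<cdot>\<^sub>v vt (j - 1 + 1) + g"
    using recurrence_Q_col[OF j] by blast
  let ?s = "QA\<^sup>T *\<^sub>v u (j + 1)"
  have sc: "?s \<in> carrier_vec n" by (rule carrier_vecI) (simp add: carrier_matD[OF QA_dim])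
  have Qc: "Q *\<^sub>v ?s \<in> carrier_vec (m + p)" "Q *\<^sub>v w \<in> carrier_vec (m + p)"
    using Q_orthonormal(1) sc w(1) by auto
  have vc: "vt (j + 1) \<in> carrier_vec (m + p)" "vt (j - 1 + 1) \<in> carrier_vec (m + p)"
    using vt_Suc[of j] vt_Suc[of "j - 1"] j by auto
  have "u (j + 1) \<bullet> (QA *\<^sub>v w) = ?s \<bullet> w"
    by (rule transpose_vec_mult_scalar[OF QA_dim w(1), symmetric]) (use u_Suc[of j] j in auto)
  also have "?s = Q\<^sup>T *\<^sub>v (Q *\<^sub>v ?s)"
    by (rule orthonormal_cols_cancel[OF Q_orthonormal sc, symmetric])
  also have "\<dots> \<bullet> w = (Q *\<^sub>v ?s) \<bullet> (Q *\<^sub>v w)"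
    by (rule transpose_vec_mult_scalar[OF Q_orthonormal(1) w(1) Qc(1)])
  also have "\<dots> = \<alpha> (j + 1) * (vt (j + 1) \<bullet> (Q *\<^sub>v w))
      + (if j = 0 then 0 else \<beta> (j + 1)) * (vt (j - 1 + 1) \<bullet> (Q *\<^sub>v w)) + g \<bullet> (Q *\<^sub>v w)"
    unfolding eq using vc g(1) Qc(2) by (simp add: add_scalar_prod_distrib[of _ "m + p"])
  finally have "u (j + 1) \<bullet> (QA *\<^sub>v w) = \<alpha> (j + 1) * (v (j + 1) \<bullet> w)
      + (if j = 0 then 0 else \<beta> (j + 1)) * (v (j - 1 + 1) \<bullet> w) + g \<bullet> (Q *\<^sub>v w)"
    using v_scalar_prod[OF j w(1)] v_scalar_prod[of "j - 1" w] w(1) j by simp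
  moreover have "\<bar>g \<bullet> (Q *\<^sub>v w)\<bar> \<le> C * \<epsilon>"
    using abs_scalar_prod_le_bound[OF Qc(2) g(1) Q_parts_norm(1)[OF w] g(2)]
    by (simp add: comm_scalar_prod[OF Qc(2) g(1)])
  ultimately show ?thesis by simp
qed

lemma v_split_relation:
  assumes w: "w \<in> carrier_vec n" "vec_norm2 w \<le> 1" and j: "j < k"
  shows "\<bar>v (j + 1) \<bullet> w -
    (\<alpha> (j + 1) * (u (j + 1) \<bullet> (QA *\<^sub>v w)) + \<beta> (j + 2) * (u (j + 2) \<bullet> (QA *\<^sub>v w))
     + (- 1) ^ j * (\<alpha>h (j + 1) * (uh (j + 1) \<bullet> (QL *\<^sub>v w)) + b j * (uh (j - 1 + 1) \<bullet> (QL *\<^sub>v w))))\<bar>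
    \<le> 2 * (C * \<epsilon>)"
proof -
  obtain f where f: "f \<in> carrier_vec m" "vec_norm2 f \<le> C * \<epsilon>" and
    xf: "vec_first (vt (j + 1)) m = \<alpha> (j + 1) \<cdot>\<^sub>v u (j + 1) + \<beta> (j + 2) \<cdot>\<^sub>v u (j + 2) + f"
    using recurrence_A_col[OF j] by blast
  obtain h where h: "h \<in> carrier_vec p" "vec_norm2 h \<le> C * \<epsilon>" and
    xh: "(- 1) ^ j \<cdot>\<^sub>v vec_last (vt (j + 1)) p =
      \<alpha>h (j + 1) \<cdot>\<^sub>v uh (j + 1) + b j \<cdot>\<^sub>v uh (j - 1 + 1) + h"
    using recurrence_L_col[OF j] by blast
  let ?wA = "QA *\<^sub>v w" and ?wL = "QL *\<^sub>v w"
  have wc: "?wA \<in> carrier_vec m" "?wL \<in> carrier_vec p" using QA_dim QL_dim w(1) by auto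
  have uc: "u (j + 1) \<in> carrier_vec m" "u (j + 2) \<in> carrier_vec m"
    "uh (j + 1) \<in> carrier_vec p" "uh (j - 1 + 1) \<in> carrier_vec p"
    using u_Suc[of j] u_Suc[of "j + 1"] uh_Suc[OF j] uh_Suc[of "j - 1"] j by auto
  have A: "vec_first (vt (j + 1)) m \<bullet> ?wA =
    \<alpha> (j + 1) * (u (j + 1) \<bullet> ?wA) + \<beta> (j + 2) * (u (j + 2) \<bullet> ?wA) + f \<bullet> ?wA"
    unfolding xf using uc f(1) wc by (simp add: add_scalar_prod_distrib[of _ m])
  have "(- 1) ^ j * (vec_last (vt (j + 1)) p \<bullet> ?wL) = ((- 1) ^ j \<cdot>\<^sub>v vec_last (vt (j + 1)) p) \<bullet> ?wL"
    using smult_scalar_prod_distrib[OF vec_last_carrier wc(2)] by simp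
  also have "\<dots> = \<alpha>h (j + 1) * (uh (j + 1) \<bullet> ?wL) + b j * (uh (j - 1 + 1) \<bullet> ?wL) + h \<bullet> ?wL"
    unfolding xh using uc h(1) wc by (simp add: add_scalar_prod_distrib[of _ p])
  finally have "(- 1) ^ j * ((- 1) ^ j * (vec_last (vt (j + 1)) p \<bullet> ?wL)) =
    (- 1) ^ j * (\<alpha>h (j + 1) * (uh (j + 1) \<bullet> ?wL) + b j * (uh (j - 1 + 1) \<bullet> ?wL) + h \<bullet> ?wL)"
    by (rule arg_cong)
  then have L: "vec_last (vt (j + 1)) p \<bullet> ?wL =
    (- 1) ^ j * (\<alpha>h (j + 1) * (uh (j + 1) \<bullet> ?wL) + b j * (uh (j - 1 + 1) \<bullet> ?wL)) + (- 1) ^ j * (h \<bullet> ?wL)"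
    by (simp only: sign_cancel distrib_left)
  have "v (j + 1) \<bullet> w = vec_first (vt (j + 1)) m \<bullet> ?wA + vec_last (vt (j + 1)) p \<bullet> ?wL"
    using v_scalar_prod[OF j w(1)] Q_split[OF _ w(1)] vt_Suc[OF j] by simp
  moreover have "\<bar>f \<bullet> ?wA\<bar> \<le> C * \<epsilon>"
    using abs_scalar_prod_le_bound[OF wc(1) f(1) Q_parts_norm(2)[OF w] f(2)]
    by (simp add: comm_scalar_prod[OF wc(1) f(1)])
  moreover have "\<bar>(- 1) ^ j * (h \<bullet> ?wL)\<bar> \<le> C * \<epsilon>"
    using abs_scalar_prod_le_bound[OF wc(2) h(1) Q_parts_norm(3)[OF w] h(2)]
    by (simp add: comm_scalar_prod[OF wc(2) h(1)] abs_mult)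
  ultimately show ?thesis unfolding A L by linarith
qed

text \<open>The adjoint relation: the first \<open>k - 1\<close> columns of \<open>QL\<^sup>T U_hat\<close> and of \<open>V B_bar\<^sup>T\<close> agree up to a
  multiple of \<open>\<theta>\<close>. The difference solves a system with matrix \<open>B_hat\<close> whose right-hand side
  is a rounding error only, free of the inverse of \<open>B_under\<close>, because the inner solves give
  \<open>QA\<^sup>T u\<close> directly in terms of the \<open>v\<close>; hence no product of the two inverses arises. Column \<open>k\<close> would
  also involve the next vector \<open>vt (k + 1)\<close>, which is not controlled, and is therefore left out.\<close>

lemma uh_QL_relation:
  assumes w: "w \<in> carrier_vec n" "vec_norm2 w \<le> 1" and j: "j + 1 < k"
  shows "\<bar>uh (j + 1) \<bullet> (QL *\<^sub>v w) -
    (- 1) ^ j * (\<alpha>h (j + 1) * (v (j + 1) \<bullet> w) - \<beta>h (j + 1) * (v (j + 2) \<bullet> w))\<bar>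
    \<le> 14 * real k * C * \<theta>"
proof -
  define y where "y i = v (i + 1) \<bullet> w" for i
  define q where "q i = uh (i + 1) \<bullet> (QL *\<^sub>v w)" for i
  define r where "r i = u (i + 1) \<bullet> (QA *\<^sub>v w)" for i
  define bt where "bt j = (if j = 0 then 0 else \<beta> (j + 1))" for j
  define d where "d i = q i - (- 1) ^ i * (\<alpha>h (i + 1) * y i - \<beta>h (i + 1) * y (i + 1))" for i
  \<comment> \<open>The difference of the two sides is \<open>d\<close>. The last unknown is chosen such that the last equation
    of the system with matrix \<open>B_hat\<close> holds exactly; the other equations do not contain it.\<close>
  define x where "x i = (if i + 1 < k then d i else - b i * d (i - 1) / \<alpha>h (i + 1))" for i
  have y1: "\<bar>y i\<bar> \<le> 1" if "i < k" for i
    unfolding y_def using abs_scalar_prod_le_bound[OF w(1) v_carrier w(2) v_gram_diagonal(1)[OF that]]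
    by (simp add: comm_scalar_prod[OF w(1) v_carrier])
  have res: "\<bar>\<Sum>i<k. x i * B_hat k \<alpha>h \<beta>h $$ (i, j)\<bar> \<le> 14 * (C * (c3 c1 c2 * \<epsilon>))" if jk: "j < k" for j
  proof (cases "j + 1 < k")
    case False
    have "\<alpha>h (j + 1) \<noteq> 0" using \<alpha>h_pos[of "j + 1"] jk by simp
    then have "(\<Sum>i<k. x i * B_hat k \<alpha>h \<beta>h $$ (i, j)) = 0"
      unfolding B_hat_sum[OF jk] x_def using False jk by auto
    then show ?thesis using c_ge_1 C_pos eps_pos by (simp add: c3_def)
  next
    case j: True
    define \<sigma> :: real where "\<sigma> = (- 1) ^ j"
    have \<sigma>: "\<sigma> * \<sigma> = 1" "\<bar>\<sigma>\<bar> = 1" by (simp_all add: \<sigma>_def flip: power_add mult_2)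
    define e1 where "e1 = y j - (\<alpha> (j + 1) * r j + \<beta> (j + 2) * r (j + 1)
      + \<sigma> * (\<alpha>h (j + 1) * q j + b j * q (j - 1)))"
    define e2 where "e2 = r j - (\<alpha> (j + 1) * y j + bt j * y (j - 1))"
    define e3 where "e3 = r (j + 1) - (\<alpha> (j + 2) * y (j + 1) + \<beta> (j + 2) * y j)"
    have e1: "\<bar>e1\<bar> \<le> 2 * (C * \<epsilon>)"
      using v_split_relation[OF w jk] by (simp add: e1_def y_def q_def r_def \<sigma>_def)
    have e2: "\<bar>e2\<bar> \<le> C * \<epsilon>"
      using u_QA_relation[OF w jk] by (simp add: e2_def y_def r_def bt_def)
    have e3: "\<bar>e3\<bar> \<le> C * \<epsilon>"
      using u_QA_relation[OF w j] by (simp add: e3_def y_def r_def)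
    obtain \<rho> where \<rho>: "\<bar>\<rho>\<bar> \<le> C * \<epsilon>" "b j * \<alpha>h (j - 1 + 1) = \<alpha> (j + 1) * bt j * (1 + \<rho>)"
    proof (cases "j = 0")
      case True
      then show ?thesis using that[of 0] C_pos eps_pos by (simp add: bt_def)
    next
      case False
      then obtain \<rho> where "\<bar>\<rho>\<bar> \<le> C * \<epsilon>" "\<beta>h j = \<alpha> (j + 1) * \<beta> (j + 1) / \<alpha>h j * (1 + \<rho>)"
        using \<beta>h_computed[of j] jk by auto
      then show ?thesis using that[of \<rho>] False \<alpha>h_pos[of j] jk by (simp add: bt_def)
    qed
    obtain \<rho>n where \<rho>n: "\<bar>\<rho>n\<bar> \<le> C * \<epsilon>"
      "\<alpha>h (j + 1) * \<beta>h (j + 1) = \<alpha> (j + 2) * \<beta> (j + 2) * (1 + \<rho>n)"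
    proof -
      obtain \<rho> where "\<bar>\<rho>\<bar> \<le> C * \<epsilon>" "\<beta>h (j + 1) = \<alpha> (j + 2) * \<beta> (j + 2) / \<alpha>h (j + 1) * (1 + \<rho>)"
        using \<beta>h_computed[of "j + 1"] j by auto
      then show ?thesis using that[of \<rho>] \<alpha>h_pos[of "j + 1"] jk by simp
    qed
    have dj: "d j = q j - \<sigma> * (\<alpha>h (j + 1) * y j - \<beta>h (j + 1) * y (j + 1))"
      by (simp add: d_def \<sigma>_def)
    have bd: "b j * d (j - 1) = b j * (q (j - 1) + \<sigma> * (\<alpha>h (j - 1 + 1) * y (j - 1) - b j * y j))"
      by (cases j) (simp_all add: d_def \<sigma>_def)
    have "\<sigma> * (\<Sum>i<k. x i * B_hat k \<alpha>h \<beta>h $$ (i, j)) =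
      \<sigma> * (\<alpha>h (j + 1) * (q j - \<sigma> * (\<alpha>h (j + 1) * y j - \<beta>h (j + 1) * y (j + 1))) +
        b j * (q (j - 1) + \<sigma> * (\<alpha>h (j - 1 + 1) * y (j - 1) - b j * y j)))"
      unfolding B_hat_sum[OF jk] bd[symmetric] dj[symmetric] using j by (simp add: x_def)
    also have "\<dots> = (1 - ((\<alpha> (j + 1))\<^sup>2 + (\<beta> (j + 2))\<^sup>2 + ((\<alpha>h (j + 1))\<^sup>2 + (b j)\<^sup>2))) * y j
        + \<alpha> (j + 1) * bt j * \<rho> * y (j - 1) + \<alpha> (j + 2) * \<beta> (j + 2) * \<rho>n * y (j + 1)
        - \<alpha> (j + 1) * e2 - \<beta> (j + 2) * e3 - e1"
      by (rule bidiagonal_residual_identity[where r = "r j" and rn = "r (j + 1)"])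
        (use \<rho>(2) \<rho>n(2) \<sigma>(1) in \<open>simp_all add: e1_def e2_def e3_def\<close>)
    finally have "\<bar>\<sigma> * (\<Sum>i<k. x i * B_hat k \<alpha>h \<beta>h $$ (i, j))\<bar> = \<bar>\<dots>\<bar>"
      by (rule arg_cong)
    note eq = this[unfolded abs_mult[of \<sigma>] \<sigma>(2) mult_1]
    note cb = coefficient_bounds[OF jk]
    have bt: "\<bar>bt j\<bar> \<le> 2"
      using coefficient_bounds(2)[of "j - 1"] jk by (cases j) (auto simp: bt_def)
    have \<alpha>n: "\<bar>\<alpha> (j + 2)\<bar> \<le> 2" using coefficient_bounds(1)[OF j] by simp
    have yy: "\<bar>y j\<bar> \<le> 1" "\<bar>y (j - 1)\<bar> \<le> 1" "\<bar>y (j + 1)\<bar> \<le> 1"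
      using y1[of j] y1[of "j - 1"] y1[of "j + 1"] j by auto
    have 1: "\<bar>(1 - ((\<alpha> (j + 1))\<^sup>2 + (\<beta> (j + 2))\<^sup>2 + ((\<alpha>h (j + 1))\<^sup>2 + (b j)\<^sup>2))) * y j\<bar>
        \<le> 7 * (C * (c3 c1 c2 * \<epsilon>)) * 1"
      by (rule abs_mult_le[OF _ yy(1)]) (use cb(5) in linarith)
    have 2: "\<bar>\<alpha> (j + 1) * bt j * \<rho> * y (j - 1)\<bar> \<le> 2 * 2 * (C * \<epsilon>) * 1"
      by (intro abs_mult_le cb bt \<rho> yy)
    have 3: "\<bar>\<alpha> (j + 2) * \<beta> (j + 2) * \<rho>n * y (j + 1)\<bar> \<le> 2 * 2 * (C * \<epsilon>) * 1"
      by (intro abs_mult_le cb \<alpha>n \<rho>n yy)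
    have 4: "\<bar>\<alpha> (j + 1) * e2\<bar> \<le> 2 * (C * \<epsilon>)" "\<bar>\<beta> (j + 2) * e3\<bar> \<le> 2 * (C * \<epsilon>)"
      by (intro abs_mult_le cb e2 e3)+
    have "2 * (C * \<epsilon>) \<le> C * (c3 c1 c2 * \<epsilon>)"
      using mult_right_mono[of 2 "c3 c1 c2" "C * \<epsilon>"] c_ge_1 C_pos eps_pos
      by (simp add: c3_def mult_ac)
    \<comment> \<open>The error terms other than the first sum up to \<open>14 * (C * \<epsilon>)\<close>, and \<open>c3 \<ge> 2\<close>.\<close>
    then show ?thesis unfolding eq using 1 2 3 4 e1 by linarith
  qed
  have "\<bar>x j\<bar> \<le> real k * (14 * (C * (c3 c1 c2 * \<epsilon>))) * mat_norm2 (mat_inv (B_hat k \<alpha>h \<beta>h))"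
    by (rule left_solve_bound[OF B_hat_carrier B_hat_invertible res]) (use j in auto)
  also have "\<dots> = 14 * real k * C * (c3 c1 c2 * \<epsilon> * mat_norm2 (mat_inv (B_hat k \<alpha>h \<beta>h)))" by simp
  also have "\<dots> \<le> 14 * real k * C * \<theta>"
    using theta_bounds(2) C_pos by (intro mult_left_mono) auto
  finally show ?thesis using j by (simp add: x_def d_def q_def y_def)
qed

end

section \<open>QR factors of semiorthogonal matrices\<close>

lemma xi_bounds:
  assumes "i < dim_col W" "j < dim_col W" "i \<noteq> j"
  shows "\<bar>col W i \<bullet> col W j\<bar> \<le> xi W"
proof -
  let ?S = "{\<bar>col W i \<bullet> col W l\<bar> | i l. i < dim_col W \<and> l < dim_col W \<and> i \<noteq> l}"
  have "?S \<subseteq> (\<lambda>(i, l). \<bar>col W i \<bullet> col W l\<bar>) ` ({..<dim_col W} \<times> {..<dim_col W})" by auto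
  then have "finite ?S" by (rule finite_subset) simp
  then show ?thesis unfolding xi_def by (intro Max_ge) (use assms in auto)
qed

lemma compact_qr_pos_facts:
  assumes W: "W \<in> carrier_mat d k" and qr: "compact_qr_pos W M R"
  shows "M \<in> carrier_mat d k" "R \<in> carrier_mat k k" "M\<^sup>T * M = 1\<^sub>m k" "W = M * R"
    "\<And>i j. j < i \<Longrightarrow> i < k \<Longrightarrow> R $$ (i, j) = 0" "\<And>i. i < k \<Longrightarrow> 0 < R $$ (i, i)"
proof -
  note q = qr[unfolded compact_qr_pos_def compact_qr_def upper_triangular_def carrier_matD[OF W]]
  show M: "M \<in> carrier_mat d k" and R: "R \<in> carrier_mat k k"
    and "M\<^sup>T * M = 1\<^sub>m k" and "W = M * R"
    using q by blast+
  show "R $$ (i, j) = 0" if "j < i" "i < k" for i j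
    using q that carrier_matD(1)[OF R] by metis
  show "0 < R $$ (i, i)" if "i < k" for i
    using q that carrier_matD(1)[OF R] by metis
qed

lemma col_orthonormal:
  fixes M :: "real mat"
  assumes M: "M \<in> carrier_mat d k" "M\<^sup>T * M = 1\<^sub>m k" and i: "i < k"
  shows "col M i \<in> carrier_vec d" "vec_norm2 (col M i) \<le> 1"
proof -
  show "col M i \<in> carrier_vec d" using M i by auto
  have "(M\<^sup>T * M) $$ (i, i) = col M i \<bullet> col M i" using M(1) i by simp
  then show "vec_norm2 (col M i) \<le> 1" using M(2) i by (simp add: vec_norm2_def)
qed

lemma col_qr_scalar_prod:
  assumes W: "W \<in> carrier_mat d k" and qr: "compact_qr_pos W M R" and i: "i < k" and j: "j < k"
  shows "col M i \<bullet> col W j = R $$ (i, j)"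
proof -
  note q = compact_qr_pos_facts[OF W qr]
  have "M\<^sup>T * (M * R) = M\<^sup>T * M * R"
    by (rule assoc_mult_mat[of _ k d _ k _ k, symmetric]) (use q in auto)
  then have "M\<^sup>T * W = R" using q(2,3) unfolding q(4)[symmetric] by simp
  moreover have "(M\<^sup>T * W) $$ (i, j) = col M i \<bullet> col W j" using q(1) W i j by simp
  ultimately show ?thesis by simp
qed

lemma mult_index_sum:
  fixes X Y :: "real mat"
  assumes "X \<in> carrier_mat a k" "Y \<in> carrier_mat k c" "i < a" "j < c"
  shows "(X * Y) $$ (i, j) = (\<Sum>l<k. X $$ (i, l) * Y $$ (l, j))"
  using assms by (simp add: scalar_prod_def atLeast0LessThan)

lemma qr_gram:
  assumes W: "W \<in> carrier_mat d k" and qr: "compact_qr_pos W M R" and ij: "i \<le> j" "j < k"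
  shows "col W i \<bullet> col W j = (\<Sum>l\<le>i. R $$ (l, i) * R $$ (l, j))"
proof -
  note q = compact_qr_pos_facts[OF W qr]
  have c: "col W l = M *\<^sub>v col R l" if "l < k" for l
    unfolding q(4) by (rule col_mult2[OF q(1,2) that])
  have Rc: "col R i \<in> carrier_vec k" "col R j \<in> carrier_vec k" using q(2) ij by auto
  have Mc: "M *\<^sub>v col R i \<in> carrier_vec d" using q(1) Rc by auto
  have "col W i \<bullet> col W j = (M *\<^sub>v col R i) \<bullet> (M *\<^sub>v col R j)" using c ij by simp
  also have "\<dots> = (M\<^sup>T *\<^sub>v (M *\<^sub>v col R i)) \<bullet> col R j"
    by (rule transpose_vec_mult_scalar[OF q(1) Rc(2) Mc, symmetric])
  also have "\<dots> = col R i \<bullet> col R j" using orthonormal_cols_cancel[OF q(1,3) Rc(1)] by simp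
  also have "\<dots> = (\<Sum>l<k. R $$ (l, i) * R $$ (l, j))"
    using q(2) ij by (simp add: scalar_prod_def atLeast0LessThan)
  also have "\<dots> = (\<Sum>l\<le>i. R $$ (l, i) * R $$ (l, j))"
    by (rule sum.mono_neutral_right) (use q(5) ij in auto)
  finally show ?thesis .
qed

lemma qr_factor_near_identity:
  assumes W: "W \<in> carrier_mat d k" and qr: "compact_qr_pos W M R"
    and norm: "\<And>j. j < k \<Longrightarrow> vec_norm2 (col W j) \<le> 1"
    and diag: "\<And>j. j < k \<Longrightarrow> \<bar>col W j \<bullet> col W j - 1\<bar> \<le> \<nu>"
    and off: "xi W \<le> \<mu>"
    and small: "\<nu> + 4 * real k * 9 ^ k * \<mu>\<^sup>2 \<le> 1 / 2"
  shows "\<And>j. j < k \<Longrightarrow> \<bar>R $$ (j, j) - 1\<bar> \<le> \<nu> + 4 * real k * 9 ^ k * \<mu>\<^sup>2"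
    and "\<And>l j. l < j \<Longrightarrow> j < k \<Longrightarrow> \<bar>R $$ (l, j)\<bar> \<le> 1"
proof -
  note q = compact_qr_pos_facts[OF W qr]
  have gram: "col W j \<bullet> col W j = (\<Sum>l\<le>j. (R $$ (l, j))\<^sup>2)" if "j < k" for j
    using qr_gram[OF W qr order_refl that] by (simp add: power2_eq_square)
  show le1: "\<bar>R $$ (l, j)\<bar> \<le> 1" if "l < j" "j < k" for l j
  proof -
    have "(R $$ (l, j))\<^sup>2 \<le> (\<Sum>l\<le>j. (R $$ (l, j))\<^sup>2)"
      by (rule member_le_sum) (use that in auto)
    also have "\<dots> \<le> 1"
      using norm[OF that(2)] gram[OF that(2)] by (simp add: vec_norm2_le_1_iff)
    finally show ?thesis by (simp add: abs_square_le_1)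
  qed
  show "\<bar>R $$ (j, j) - 1\<bar> \<le> \<nu> + 4 * real k * 9 ^ k * \<mu>\<^sup>2" if "j < k" for j
  proof (rule cholesky_diagonal_near_one[where S = "\<lambda>l j. R $$ (l, j)"])
    fix i j assume "i < j" "j < k"
    then have "\<bar>col W i \<bullet> col W j\<bar> \<le> \<mu>" using xi_bounds[of i W j] W off by auto
    then show "\<bar>\<Sum>l\<le>i. R $$ (l, i) * R $$ (l, j)\<bar> \<le> \<mu>"
      using qr_gram[OF W qr, of i j] \<open>i < j\<close> \<open>j < k\<close> by simp
  qed (use q(6) le1 diag gram small that in auto)
qed

section \<open>The projected matrix\<close>

context jbd_small_roundoff
begin

text \<open>Multiplied by the triangular factors from either side, the matrix in question is known up to
  \<open>\<theta>\<close>. From the right, the forward relation shows that the lower triangle and the diagonal of its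
  product with \<open>S\<close> agree with \<open>R B_bar\<close>, where only the diagonals of the factors enter; from
  the left, the adjoint relation does the same for the strict upper triangle. Forward substitution
  removes the factors in each case. Neither relation alone would do: the off-diagonal entries of the factors
  are only of the size of the square root of \<open>\<theta>\<close>.\<close>

lemma projected_matrix_near_B_bar:
  fixes Mh Rh N S :: "real mat"
  assumes qrU: "compact_qr_pos (seq_mat p k uh) Mh Rh" and qrV: "compact_qr_pos (V_mat n k Q vt) N S"
    and diagR: "\<And>j. j < k \<Longrightarrow> \<bar>Rh $$ (j, j) - 1\<bar> \<le> s" and diagS: "\<And>j. j < k \<Longrightarrow> \<bar>S $$ (j, j) - 1\<bar> \<le> s"
    and offR: "\<And>l j. l < j \<Longrightarrow> j < k \<Longrightarrow> \<bar>Rh $$ (l, j)\<bar> \<le> 1"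
    and offS: "\<And>l j. l < j \<Longrightarrow> j < k \<Longrightarrow> \<bar>S $$ (l, j)\<bar> \<le> 1"
    and s: "s \<le> 1 / 2" and i: "i < k" and j: "j < k"
  shows "\<bar>(Mh\<^sup>T * QL * N) $$ (i, j) - B_bar k \<alpha>h \<beta>h $$ (i, j)\<bar>
    \<le> 2 * 3 ^ k * (14 * real k * C * \<theta> + 4 * s)"
proof -
  let ?T = "Mh\<^sup>T * QL * N" and ?B = "B_bar k \<alpha>h \<beta>h"
  let ?d = "14 * real k * C * \<theta> + 4 * s"
  have Uc: "seq_mat p k uh \<in> carrier_mat p k" by (rule seq_mat_carrier)
  have Vc: "V_mat n k Q vt \<in> carrier_mat n k" unfolding V_mat_def by (rule seq_mat_carrier)
  note qU = compact_qr_pos_facts[OF Uc qrU] and qV = compact_qr_pos_facts[OF Vc qrV]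
  have colU: "col (seq_mat p k uh) l = uh (l + 1)" if "l < k" for l
    using col_seq_mat[of l k uh p] uh_Suc[OF that] that by simp
  have colV: "col (V_mat n k Q vt) l = v (l + 1)" if "l < k" for l
    unfolding V_mat_def using col_seq_mat[of l k "\<lambda>i. v i" n] v_carrier that by simp
  have Tc: "?T \<in> carrier_mat k k" using qU(1) qV(1) QL_dim by auto
  have k1: "1 \<le> real k" using k_pos by simp
  have C\<theta>: "0 \<le> C * \<theta>" using C_pos theta_bounds(3) eps_pos by simp
  have s0: "0 \<le> s" using diagR[OF i] by linarith
  have TS: "(\<Sum>l\<le>j. ?T $$ (i, l) * S $$ (l, j)) = col Mh i \<bullet> (QL *\<^sub>v v (j + 1))"
    if "i < k" "j < k" for i j
  proof -
    have "?T * S = Mh\<^sup>T * QL * (N * S)"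
      by (rule assoc_mult_mat[of _ k n _ k _ k]) (use qU(1) qV(1,2) QL_dim in auto)
    also have "\<dots> = Mh\<^sup>T * (QL * (N * S))"
      by (rule assoc_mult_mat[of _ k p _ n _ k]) (use qU(1) qV(1,2) QL_dim in auto)
    finally have "?T * S = Mh\<^sup>T * (QL * V_mat n k Q vt)" unfolding qV(4) .
    moreover have "(Mh\<^sup>T * (QL * V_mat n k Q vt)) $$ (i, j) = col Mh i \<bullet> col (QL * V_mat n k Q vt) j"
      using qU(1) QL_dim Vc that by simp
    moreover have "col (QL * V_mat n k Q vt) j = QL *\<^sub>v v (j + 1)"
      using col_mult2[OF QL_dim Vc that(2)] colV[OF that(2)] by simp
    moreover have "(?T * S) $$ (i, j) = (\<Sum>l<k. ?T $$ (i, l) * S $$ (l, j))"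
      by (rule mult_index_sum[OF Tc qV(2) that])
    moreover have "\<dots> = (\<Sum>l\<le>j. ?T $$ (i, l) * S $$ (l, j))"
      by (rule sum.mono_neutral_right) (use qV(5) that in auto)
    ultimately show ?thesis by simp
  qed
  have RT: "(\<Sum>l\<le>i. ?T $$ (l, j) * Rh $$ (l, i)) = uh (i + 1) \<bullet> (QL *\<^sub>v col N j)"
    if "i < k" "j < k" for i j
  proof -
    have QN: "QL * N \<in> carrier_mat p k" using QL_dim qV(1) by simp
    have "?T = Mh\<^sup>T * (QL * N)"
      by (rule assoc_mult_mat[of _ k p _ n _ k]) (use qU(1) qV(1) QL_dim in auto)
    then have "Rh\<^sup>T * ?T = Rh\<^sup>T * (Mh\<^sup>T * (QL * N))" by simp
    also have "\<dots> = Rh\<^sup>T * Mh\<^sup>T * (QL * N)"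
      by (rule assoc_mult_mat[of _ k k _ p _ k, symmetric]) (use qU(1,2) QN in auto)
    also have "Rh\<^sup>T * Mh\<^sup>T = (seq_mat p k uh)\<^sup>T"
      unfolding qU(4) by (rule transpose_mult[OF qU(1,2), symmetric])
    finally have "Rh\<^sup>T * ?T = (seq_mat p k uh)\<^sup>T * (QL * N)" .
    moreover have "((seq_mat p k uh)\<^sup>T * (QL * N)) $$ (i, j) = uh (i + 1) \<bullet> col (QL * N) j"
      using Uc qV(1) that colU[OF that(1)] by simp
    moreover have "col (QL * N) j = QL *\<^sub>v col N j"
      by (rule col_mult2[OF QL_dim qV(1) that(2)])
    moreover have "(Rh\<^sup>T * ?T) $$ (i, j) = (\<Sum>l<k. Rh\<^sup>T $$ (i, l) * ?T $$ (l, j))"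
      by (rule mult_index_sum[OF _ Tc that]) (use qU(2) in simp)
    moreover have "\<dots> = (\<Sum>l<k. ?T $$ (l, j) * Rh $$ (l, i))"
      using qU(2) that by (intro sum.cong) (auto simp: mult.commute)
    moreover have "\<dots> = (\<Sum>l\<le>i. ?T $$ (l, j) * Rh $$ (l, i))"
      by (rule sum.mono_neutral_right) (use qU(5) that in auto)
    ultimately show ?thesis by simp
  qed
  have half: "1 / 2 \<le> Rh $$ (l, l)" "1 / 2 \<le> S $$ (l, l)" if "l < k" for l
    using diagR[OF that] diagS[OF that] s by linarith+
  have le3k: "2 * 3 ^ l * ?d \<le> 2 * 3 ^ k * ?d" if "l < k" for l
  proof -
    have "0 \<le> 14 * real k * (C * \<theta>) + 4 * s" using C\<theta> s0 by simp
    then have "0 \<le> ?d" by (simp only: mult.assoc)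
    then show ?thesis
      using that by (intro mult_right_mono mult_left_mono power_increasing) auto
  qed
  show ?thesis
  proof (cases "j \<le> i")
    case True
    have w: "col Mh i \<in> carrier_vec p" "vec_norm2 (col Mh i) \<le> 1"
      using col_orthonormal[OF qU(1,3) i] by auto
    have wu: "col Mh i \<bullet> uh (l + 1) = Rh $$ (i, l)" if "l < k" for l
      using col_qr_scalar_prod[OF Uc qrU i that] colU[OF that] by simp
    have "\<bar>?T $$ (i, j) - ?B $$ (i, j)\<bar> \<le> 2 * 3 ^ j * ?d"
    proof (rule forward_substitution_bound[where x = "\<lambda>l. ?T $$ (i, l) - ?B $$ (i, l)"
          and S = "\<lambda>l j. S $$ (l, j)" and n = "i + 1"])
      fix j assume "j < i + 1"
      then have j: "j < k" and ji: "j \<le> i" using i by auto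
      define a where "a = (if j = i then (- 1) ^ i * \<alpha>h (i + 1) else 0)"
      have a: "\<bar>a\<bar> \<le> 2" using coefficient_bounds(3)[OF i] by (simp add: a_def abs_mult)
      have prev: "b j * Rh $$ (i, j - 1) = 0" using qU(5)[of "j - 1" i] i ji by auto
      have "\<bar>col Mh i \<bullet> (QL *\<^sub>v v (j + 1)) - (- 1) ^ j * (\<alpha>h (j + 1) * Rh $$ (i, j))\<bar> \<le> 3 * real k * C * \<theta>"
        using QL_v_relation[OF w j] wu[OF j] wu[of "j - 1"] prev j by (simp only: less_imp_diff_less add_0_right)
      moreover have "(- 1) ^ j * (\<alpha>h (j + 1) * Rh $$ (i, j)) = a * Rh $$ (i, i)"
        using ji qU(5)[of j i] i by (auto simp: a_def)
      moreover have "(\<Sum>l\<le>j. ?B $$ (i, l) * S $$ (l, j)) = a * S $$ (i, i)"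
      proof -
        have "(\<Sum>l\<le>j. ?B $$ (i, l) * S $$ (l, j)) = (\<Sum>l\<le>j. if l = i then a * S $$ (i, i) else 0)"
          by (rule sum.cong) (use i ji in \<open>auto simp: B_bar_index a_def\<close>)
        then show ?thesis using ji by (auto simp: a_def)
      qed
      moreover have "\<bar>a * (Rh $$ (i, i) - S $$ (i, i))\<bar> \<le> 2 * (2 * s)"
        by (rule abs_mult_le[OF a]) (use diagR[OF i] diagS[OF i] in linarith)
      moreover have "(\<Sum>l\<le>j. (?T $$ (i, l) - ?B $$ (i, l)) * S $$ (l, j)) =
        (\<Sum>l\<le>j. ?T $$ (i, l) * S $$ (l, j)) - (\<Sum>l\<le>j. ?B $$ (i, l) * S $$ (l, j))"
        by (simp only: left_diff_distrib sum_subtractf)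
      moreover have "3 * real k * C * \<theta> \<le> 14 * real k * C * \<theta>"
      proof -
        have "3 * (real k * (C * \<theta>)) \<le> 14 * (real k * (C * \<theta>))"
          using mult_nonneg_nonneg[OF of_nat_0_le_iff[of k] C\<theta>] by linarith
        then show ?thesis by (simp only: mult.assoc)
      qed
      ultimately show "\<bar>\<Sum>l\<le>j. (?T $$ (i, l) - ?B $$ (i, l)) * S $$ (l, j)\<bar> \<le> ?d"
        unfolding TS[OF i j] right_diff_distrib by linarith
    qed (use half offS i True in auto)
    then show ?thesis using le3k[OF j] by linarith
  next
    case False
    have w: "col N j \<in> carrier_vec n" "vec_norm2 (col N j) \<le> 1"
      using col_orthonormal[OF qV(1,3) j] by auto
    have wv: "v (l + 1) \<bullet> col N j = S $$ (j, l)" if "l < k" for l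
      using col_qr_scalar_prod[OF Vc qrV j that] colV[OF that] comm_scalar_prod[OF v_carrier w(1)] by simp
    have "\<bar>?T $$ (i, j) - ?B $$ (i, j)\<bar> \<le> 2 * 3 ^ i * ?d"
    proof (rule forward_substitution_bound[where x = "\<lambda>l. ?T $$ (l, j) - ?B $$ (l, j)"
          and S = "\<lambda>l j. Rh $$ (l, j)" and n = j])
      fix i assume ij: "i < j"
      then have i: "i < k" and i1: "i + 1 < k" using j by auto
      define a where "a = (if i + 1 = j then (- 1) ^ j * \<beta>h j else 0)"
      have a: "\<bar>a\<bar> \<le> 2" using coefficient_bounds(4)[OF j] ij by (simp add: a_def abs_mult)
      have "S $$ (j, i) = 0" using qV(5)[of i j] ij j by simp
      then have "\<bar>uh (i + 1) \<bullet> (QL *\<^sub>v col N j) - (- 1) ^ i * (- (\<beta>h (i + 1) * S $$ (j, i + 1)))\<bar>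
          \<le> 14 * real k * C * \<theta>"
        using uh_QL_relation[OF w i1] wv[OF i] wv[OF i1] by simp
      moreover have "(- 1) ^ i * (- (\<beta>h (i + 1) * S $$ (j, i + 1))) = a * S $$ (j, j)"
      proof (cases "i + 1 = j")
        case False
        then show ?thesis using qV(5)[of "i + 1" j] ij j by (simp add: a_def)
      qed (auto simp: a_def)
      moreover have "(\<Sum>l\<le>i. ?B $$ (l, j) * Rh $$ (l, i)) = a * Rh $$ (i, i)"
      proof -
        have "(\<Sum>l\<le>i. ?B $$ (l, j) * Rh $$ (l, i)) = (\<Sum>l\<le>i. if l = i then a * Rh $$ (i, i) else 0)"
          by (rule sum.cong) (use j ij in \<open>auto simp: B_bar_index a_def\<close>)
        then show ?thesis by simp
      qed
      moreover have "\<bar>a * (S $$ (j, j) - Rh $$ (i, i))\<bar> \<le> 2 * (2 * s)"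
        by (rule abs_mult_le[OF a]) (use diagR[OF i] diagS[OF j] in linarith)
      moreover have "(\<Sum>l\<le>i. (?T $$ (l, j) - ?B $$ (l, j)) * Rh $$ (l, i)) =
        (\<Sum>l\<le>i. ?T $$ (l, j) * Rh $$ (l, i)) - (\<Sum>l\<le>i. ?B $$ (l, j) * Rh $$ (l, i))"
        by (simp only: left_diff_distrib sum_subtractf)
      ultimately show "\<bar>\<Sum>l\<le>i. (?T $$ (l, j) - ?B $$ (l, j)) * Rh $$ (l, i)\<bar> \<le> ?d"
        unfolding RT[OF i j] right_diff_distrib by linarith
    qed (use half offR j False in auto)
    then show ?thesis using le3k[OF i] by linarith
  qed
qed

end

theorem theorem4p2:
  fixes k :: nat and C c \<kappa> :: real
  assumes "1 \<le> k" and "0 < C" and "1 < c" and "0 < \<kappa>"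
  shows "\<exists>K > 0. \<exists>\<eta> > 0. \<forall>c1 \<ge> 1. \<forall>c2 \<ge> 1. \<exists>K' > 0.
    \<forall>m n p A L QA QL R \<epsilon> u vt uh \<alpha> \<beta> \<alpha>h \<beta>h \<delta> Mh Rh N S.
      jbd_finite_precision m n p A L QA QL R k C c1 c2 \<epsilon> u vt uh \<alpha> \<beta> \<alpha>h \<beta>h \<longrightarrow>
      mat_norm2 (mat_inv (B_bar k \<alpha>h \<beta>h * B_under k \<alpha> \<beta>))
        \<le> c * sqrt 2 * (mat_norm2 (mat_inv (B_bar k \<alpha>h \<beta>h)) + mat_norm2 (mat_inv (B_under k \<alpha> \<beta>))) \<longrightarrow>
      \<epsilon> \<le> \<eta> \<longrightarrow> c4 c1 c2 k \<alpha> \<beta> \<alpha>h \<beta>h * \<epsilon> \<le> \<eta> \<longrightarrow>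
      \<delta> = \<kappa> * c4 c1 c2 k \<alpha> \<beta> \<alpha>h \<beta>h * \<epsilon> \<longrightarrow>
      compact_qr_pos (seq_mat p k uh) Mh Rh \<longrightarrow>
      compact_qr_pos (V_mat n k (QA @\<^sub>r QL) vt) N S \<longrightarrow>
      xi (seq_mat p k uh) \<le> sqrt (\<delta> / (2 * real k + 1)) \<longrightarrow>
      xi (V_mat n k (QA @\<^sub>r QL) vt) \<le> sqrt (\<delta> / (2 * real k + 1)) \<longrightarrow>
      (\<exists>E \<in> carrier_mat k k.
         Mh\<^sup>T * QL * N = B_bar k \<alpha>h \<beta>h + E \<and>
         (\<forall>i < k. \<forall>j < k. \<bar>E $$ (i, j)\<bar> \<le> K * \<delta>) \<and>
         \<delta> \<le> K' * ((mat_norm2 (mat_inv (B_under k \<alpha> \<beta>)) + mat_norm2 (mat_inv (B_bar k \<alpha>h \<beta>h))) * \<epsilon>))"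
proof -
  \<comment> \<open>\<open>\<Lambda> \<theta>\<close> bounds the deviation of the diagonals of the triangular factors from 1.\<close>
  define \<Lambda> where "\<Lambda> = 2 * real k * C + 4 * real k * 9 ^ k * \<kappa>"
  define K where "K = 2 * 3 ^ k * (14 * real k * C + 4 * \<Lambda>) / \<kappa>"
  \<comment> \<open>Chosen such that both \<open>C * \<eta> \<le> 1 / 16\<close>, for the coefficient bounds, and \<open>\<Lambda> * \<eta> \<le> 1 / 2\<close>, for the
    triangular factors.\<close>
  define \<eta> where "\<eta> = 1 / (16 * C + 2 * \<Lambda>)"
  have k0: "0 < real k" using assms by simp
  have \<Lambda>0: "0 < \<Lambda>" unfolding \<Lambda>_def using k0 assms by (intro add_pos_pos mult_pos_pos) auto
  have K0: "0 < K" unfolding K_def using k0 assms \<Lambda>0 by (intro divide_pos_pos mult_pos_pos add_pos_pos) auto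
  have \<eta>0: "0 < \<eta>" unfolding \<eta>_def using assms \<Lambda>0 by simp
  have "(16 * C + 2 * \<Lambda>) * \<eta> = 1" unfolding \<eta>_def using assms \<Lambda>0 by simp
  then have \<eta>eq: "16 * (C * \<eta>) + 2 * (\<Lambda> * \<eta>) = 1" by (simp add: algebra_simps)
  have \<eta>le: "C * \<eta> \<le> 1 / 16" "\<Lambda> * \<eta> \<le> 1 / 2"
    using \<eta>eq mult_pos_pos[OF assms(2) \<eta>0] mult_pos_pos[OF \<Lambda>0 \<eta>0] by linarith+
  show ?thesis
  proof (rule exI[of _ K], rule conjI[OF K0], rule exI[of _ \<eta>], rule conjI[OF \<eta>0], intro allI impI)
    fix c1 c2 :: real
    assume c12: "1 \<le> c1" "1 \<le> c2"
    have c3: "2 \<le> c3 c1 c2" using c12 by (simp add: c3_def)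
    \<comment> \<open>Since \<open>c3 \<ge> 1\<close>, the factor \<open>c3\<close> can be taken out of \<open>c4\<close>.\<close>
    show "\<exists>K' > 0. \<forall>m n p A L QA QL R \<epsilon> u vt uh \<alpha> \<beta> \<alpha>h \<beta>h \<delta> Mh Rh N S.
      jbd_finite_precision m n p A L QA QL R k C c1 c2 \<epsilon> u vt uh \<alpha> \<beta> \<alpha>h \<beta>h \<longrightarrow>
      mat_norm2 (mat_inv (B_bar k \<alpha>h \<beta>h * B_under k \<alpha> \<beta>))
        \<le> c * sqrt 2 * (mat_norm2 (mat_inv (B_bar k \<alpha>h \<beta>h)) + mat_norm2 (mat_inv (B_under k \<alpha> \<beta>))) \<longrightarrow>
      \<epsilon> \<le> \<eta> \<longrightarrow> c4 c1 c2 k \<alpha> \<beta> \<alpha>h \<beta>h * \<epsilon> \<le> \<eta> \<longrightarrow>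
      \<delta> = \<kappa> * c4 c1 c2 k \<alpha> \<beta> \<alpha>h \<beta>h * \<epsilon> \<longrightarrow>
      compact_qr_pos (seq_mat p k uh) Mh Rh \<longrightarrow>
      compact_qr_pos (V_mat n k (QA @\<^sub>r QL) vt) N S \<longrightarrow>
      xi (seq_mat p k uh) \<le> sqrt (\<delta> / (2 * real k + 1)) \<longrightarrow>
      xi (V_mat n k (QA @\<^sub>r QL) vt) \<le> sqrt (\<delta> / (2 * real k + 1)) \<longrightarrow>
      (\<exists>E \<in> carrier_mat k k.
         Mh\<^sup>T * QL * N = B_bar k \<alpha>h \<beta>h + E \<and>
         (\<forall>i < k. \<forall>j < k. \<bar>E $$ (i, j)\<bar> \<le> K * \<delta>) \<and>
         \<delta> \<le> K' * ((mat_norm2 (mat_inv (B_under k \<alpha> \<beta>)) + mat_norm2 (mat_inv (B_bar k \<alpha>h \<beta>h))) * \<epsilon>))"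
    proof (intro exI[of _ "\<kappa> * c3 c1 c2"] conjI allI impI)
      show "0 < \<kappa> * c3 c1 c2" using assms c3 by simp
      fix m n p A L QA QL R \<epsilon> u vt uh \<alpha> \<beta> \<alpha>h \<beta>h \<delta> Mh Rh N S
      assume jbd: "jbd_finite_precision m n p A L QA QL R k C c1 c2 \<epsilon> u vt uh \<alpha> \<beta> \<alpha>h \<beta>h"
        and eps: "\<epsilon> \<le> \<eta>" and th: "c4 c1 c2 k \<alpha> \<beta> \<alpha>h \<beta>h * \<epsilon> \<le> \<eta>"
        and \<delta>: "\<delta> = \<kappa> * c4 c1 c2 k \<alpha> \<beta> \<alpha>h \<beta>h * \<epsilon>"
        and qrU: "compact_qr_pos (seq_mat p k uh) Mh Rh"
        and qrV: "compact_qr_pos (V_mat n k (QA @\<^sub>r QL) vt) N S"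
        and xiU: "xi (seq_mat p k uh) \<le> sqrt (\<delta> / (2 * real k + 1))"
        and xiV: "xi (V_mat n k (QA @\<^sub>r QL) vt) \<le> sqrt (\<delta> / (2 * real k + 1))"
      interpret jbd_small_roundoff m n p A L QA QL R k C c1 c2 \<epsilon> u vt uh \<alpha> \<beta> \<alpha>h \<beta>h
      proof (intro jbd_small_roundoff.intro jbd jbd_small_roundoff_axioms.intro assms(1,2) c12)
        have "C * \<epsilon> \<le> C * \<eta>" using eps assms by simp
        then show "C * \<epsilon> \<le> 1 / 8" using \<eta>le by linarith
        have "C * (c4 c1 c2 k \<alpha> \<beta> \<alpha>h \<beta>h * \<epsilon>) \<le> C * \<eta>" using th assms by simp
        then show "2 * C * (c4 c1 c2 k \<alpha> \<beta> \<alpha>h \<beta>h * \<epsilon>) \<le> 1 / 8" using \<eta>le by linarith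
      qed
      define \<mu> where "\<mu> = sqrt (\<delta> / (2 * real k + 1))"
      have \<theta>0: "0 < \<theta>" using theta_bounds(3) eps_pos by linarith
      have \<delta>\<theta>: "\<delta> = \<kappa> * \<theta>" by (simp add: \<delta>)
      then have \<delta>0: "0 \<le> \<delta>" using assms \<theta>0 by simp
      have "\<mu>\<^sup>2 = \<delta> / (2 * real k + 1)" using \<delta>0 by (simp add: \<mu>_def)
      also have "\<dots> \<le> \<delta> / 1" using \<delta>0 k0 by (intro divide_left_mono) auto
      finally have "4 * real k * 9 ^ k * \<mu>\<^sup>2 \<le> 4 * real k * 9 ^ k * (\<kappa> * \<theta>)"
        using \<delta>\<theta> by (intro mult_left_mono) auto
      then have dev: "2 * real k * C * \<theta> + 4 * real k * 9 ^ k * \<mu>\<^sup>2 \<le> \<Lambda> * \<theta>"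
        by (simp add: \<Lambda>_def algebra_simps)
      have "\<Lambda> * \<theta> \<le> \<Lambda> * \<eta>" using th \<Lambda>0 by simp
      then have \<Lambda>half: "\<Lambda> * \<theta> \<le> 1 / 2" using \<eta>le by linarith
      have small: "2 * real k * C * \<theta> + 4 * real k * 9 ^ k * \<mu>\<^sup>2 \<le> 1 / 2"
        using dev \<Lambda>half by linarith
      have Vc: "V_mat n k Q vt \<in> carrier_mat n k" unfolding V_mat_def by (rule seq_mat_carrier)
      have colU: "col (seq_mat p k uh) l = uh (l + 1)" if "l < k" for l
        using col_seq_mat[of l k uh p] uh_Suc[OF that] that by simp
      have colV: "col (V_mat n k Q vt) l = v (l + 1)" if "l < k" for l
        unfolding V_mat_def using col_seq_mat[of l k "\<lambda>i. v i" n] v_carrier that by simp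
      have diagU: "\<bar>uh (l + 1) \<bullet> uh (l + 1) - 1\<bar> \<le> 2 * real k * C * \<theta>" if "l < k" for l
        using uh_Suc[OF that] assms \<theta>0 by (simp add: vec_norm2_eq_1_iff)
      note R = qr_factor_near_identity[OF seq_mat_carrier qrU _ _ xiU[folded \<mu>_def] small]
      note S = qr_factor_near_identity[OF Vc qrV _ _ xiV[folded \<mu>_def] small]
      have Rdiag: "\<bar>Rh $$ (l, l) - 1\<bar> \<le> \<Lambda> * \<theta>" if "l < k" for l
        using R(1)[OF _ _ that] colU uh_Suc diagU dev by fastforce
      have Roff: "\<bar>Rh $$ (l, j)\<bar> \<le> 1" if "l < j" "j < k" for l j
        using R(2)[OF _ _ that] colU uh_Suc diagU by simp
      have Sdiag: "\<bar>S $$ (l, l) - 1\<bar> \<le> \<Lambda> * \<theta>" if "l < k" for l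
        using S(1)[OF _ _ that] colV v_gram_diagonal dev by fastforce
      have Soff: "\<bar>S $$ (l, j)\<bar> \<le> 1" if "l < j" "j < k" for l j
        using S(2)[OF _ _ that] colV v_gram_diagonal by simp
      let ?T = "Mh\<^sup>T * QL * N" and ?B = "B_bar k \<alpha>h \<beta>h"
      have Tc: "?T \<in> carrier_mat k k"
        using compact_qr_pos_facts(1)[OF seq_mat_carrier qrU] compact_qr_pos_facts(1)[OF Vc qrV] QL_dim
        by auto
      have Bc: "?B \<in> carrier_mat k k" by (rule B_bar_carrier)
      show "\<exists>E \<in> carrier_mat k k. ?T = ?B + E \<and> (\<forall>i < k. \<forall>j < k. \<bar>E $$ (i, j)\<bar> \<le> K * \<delta>) \<and>
        \<delta> \<le> \<kappa> * c3 c1 c2 * ((mat_norm2 (mat_inv (B_under k \<alpha> \<beta>)) + mat_norm2 (mat_inv ?B)) * \<epsilon>)"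
      proof (intro bexI[of _ "?T - ?B"] conjI allI impI)
        show "?T - ?B \<in> carrier_mat k k" by (rule minus_carrier_mat[OF Bc])
        show "?T = ?B + (?T - ?B)" using Tc Bc by (intro eq_matI) (auto simp del: index_mult_mat(1))
        fix i j assume i: "i < k" and j: "j < k"
        have "(?T - ?B) $$ (i, j) = ?T $$ (i, j) - ?B $$ (i, j)"
          using Bc i j by simp
        moreover have "\<bar>?T $$ (i, j) - ?B $$ (i, j)\<bar> \<le> 2 * 3 ^ k * (14 * real k * C * \<theta> + 4 * (\<Lambda> * \<theta>))"
          by (rule projected_matrix_near_B_bar[OF qrU qrV Rdiag Sdiag Roff Soff \<Lambda>half i j])
        moreover have "\<dots> = K * \<delta>" unfolding K_def \<delta>\<theta> using assms by (simp add: field_simps)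
        ultimately show "\<bar>(?T - ?B) $$ (i, j)\<bar> \<le> K * \<delta>" by simp
      next
        let ?u = "mat_norm2 (mat_inv (B_under k \<alpha> \<beta>))" and ?h = "mat_norm2 (mat_inv (B_hat k \<alpha>h \<beta>h))"
        have "?u * 1 \<le> ?u * c3 c1 c2" using c3 mat_norm2_nonneg by (intro mult_left_mono) auto
        then have "c4 c1 c2 k \<alpha> \<beta> \<alpha>h \<beta>h \<le> c3 c1 c2 * (?u + ?h)"
          unfolding c4_def by (simp add: algebra_simps)
        then have "\<kappa> * (c4 c1 c2 k \<alpha> \<beta> \<alpha>h \<beta>h * \<epsilon>) \<le> \<kappa> * (c3 c1 c2 * (?u + ?h) * \<epsilon>)"
          using assms eps_pos by (intro mult_left_mono mult_right_mono) auto
        then show "\<delta> \<le> \<kappa> * c3 c1 c2 * ((?u + mat_norm2 (mat_inv ?B)) * \<epsilon>)"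
          unfolding \<delta> mat_norm2_inv_B_bar[OF B_hat_invertible] by (simp add: mult.assoc)
      qed
    qed
  qed
qed

end
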